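(* In the setting described in the context, assume that $(E_{1,t})_t,(E_{2,t})_t,\dots,(E_{n,t})_t$ in the model $Y=XB+E$ are independent AR(1) processes satisfying $$E_{i,t}-\phi_1E_{i,t-1}=Z_{i,t},\quad\forall i\in\{1,\dots,n\},$$ where the $Z_{i,t}$'s are zero-mean i.i.d. Gaussian random variables with variance $\sigma^2$ and $|\phi_1|<1$. Let $\widehat\Sigma$ be the $q\times q$ matrix with entries $$\widehat\Sigma_{k,l}=\frac{\widehat\phi_1^{|k-l|}}{1-\widehat\phi_1^2},\quad 1\le k,l\le q,\qquad\text{where}\qquad \widehat\phi_1=\frac{\sum_{i=1}^n\sum_{\ell=2}^q\widehat E_{i,\ell}\widehat E_{i,\ell-1}}{\sum_{i=1}^n\sum_{\ell=1}^{q-1}\widehat E_{i,\ell}^2}.$$ Then the following hold, where $\Sigma$ is the covariance matrix of a row of $E$: (A7) there is a positive constant $M_6$ such that $\lambda_{\max}(\Sigma^{-1})\le M_6$ for all $n\ge1$; (A8) there is a positive constant $M_7$ such that $\lambda_{\min}(\Sigma^{-1})\ge M_7$ for all $n\ge1$; (A9) $\|\Sigma^{-1}-\widehat\Sigma^{-1}\|_\infty=O_P((nq)^{-1/2})$ as $n\to\infty$; (A10) $\rho(\Sigma-\widehat\Sigma)=O_P((nq)^{-1/2})$ as $n\to\infty$.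
   Context: Multivariate linear model: $Y=XB+E$ with $Y$ an $n\times q$ random response matrix, $X$ an $n\times p$ design matrix, $B$ a $p\times q$ coefficient matrix and $E=(E_{i,t})_{1\le i\le n,1\le t\le q}$ an $n\times q$ random error matrix with independent rows, such that for each $i\in\{1,\dots,n\}$, $(E_{i,1},\dots,E_{i,q})\sim\mathcal{N}(0,\Sigma)$; thus $\Sigma$ is the $q\times q$ covariance matrix of each row of $E$. The number $p$ is fixed and smaller than $n$, $X'X$ is invertible ($'$ denotes transpose), and $q=q_n\geq 2$ may depend on $n$ and tend to infinity. The AR(1) processes are the stationary ones, $E_{i,t}=\sum_{j\ge0}\phi_1^jZ_{i,t-j}$, and $\phi_1$, $\sigma^2$ do not depend on $n$. $\widehat E=(\widehat E_{i,\ell})_{1\le i\le n,1\le\ell\le q}$ is the matrix of least-squares residuals obtained by fitting a classical linear model to each column of $Y$: $\widehat E=\Pi E$ with $\Pi=\mathrm{Id}_{\mathbb{R}^n}-X(X'X)^{-1}X'$. $\lambda_{\max}(A)$, $\lambda_{\min}(A)$, $\rho(A)$ and $\|A\|_\infty$ denote the largest eigenvalue, the smallest eigenvalue, the spectral radius, and the matrix norm induced by the vector $\ell_\infty$ norm. $O_P$ denotes boundedness in probability.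
   Formalization: As printed, (A9) and (A10) fail when σ² ≠ 1, because Σ carries the factor σ² and Σ̂ does not; they are proved as printed for σ² = 1, and for every σ² > 0 with Σ̂ replaced by σ²Σ̂; (A7) and (A8) are proved for every σ² > 0. *)

theory Defs
  imports
    "HOL-Probability.Probability"
    "Jordan_Normal_Form.Spectral_Radius"
    "Jordan_Normal_Form.Gauss_Jordan_Elimination"
begin

unbundle no vec_syntax
hide_const (open) Finite_Cartesian_Product.vec Finite_Cartesian_Product.mat
  Finite_Cartesian_Product.transpose Determinants.det

text \<open>Rows, columns and vector entries are indexed from 0 in matrices (type \<^typ>\<open>'a mat\<close>), whereas
  the processes and the errors are indexed from 1, so entry \<open>(i, t)\<close> of an error matrix is
  the error \<open>(i + 1, t + 1)\<close>.\<close>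

section \<open>Matrix norms, eigenvalues and inverses\<close>

text \<open>The value is unspecified if \<open>A\<close> is not invertible.\<close>

definition mat_inv :: "'a :: field mat \<Rightarrow> 'a mat" where
  "mat_inv A = the (mat_inverse A)"

lemma mat_inv:
  fixes A :: "'a :: field mat"
  assumes A: "A \<in> carrier_mat n n" and inv: "invertible_mat A"
  shows "mat_inv A \<in> carrier_mat n n" "A * mat_inv A = 1\<^sub>m n" "mat_inv A * A = 1\<^sub>m n"
proof -
  obtain B where AB: "A * B = 1\<^sub>m (dim_row A)" and BA: "B * A = 1\<^sub>m (dim_row B)"
    using inv unfolding invertible_mat_def inverts_mat_def by blast
  have "dim_col B = n" using arg_cong[OF AB, of dim_col] A by simp
  moreover have "dim_row B = n" using arg_cong[OF BA, of dim_col] A by simp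
  ultimately have B: "B \<in> carrier_mat n n" by blast
  have "A \<in> Units (ring_mat TYPE('a) n ())"
    unfolding Units_def using A B AB BA by (auto simp: ring_mat_simps)
  then obtain C where C: "mat_inverse A = Some C"
    using mat_inverse(1)[OF A, of "()"] by (cases "mat_inverse A") auto
  from mat_inverse(2)[OF A C]
  show "mat_inv A \<in> carrier_mat n n" "A * mat_inv A = 1\<^sub>m n" "mat_inv A * A = 1\<^sub>m n"
    unfolding mat_inv_def C by auto
qed

text \<open>The next two are used for real symmetric matrices, all of whose eigenvalues are real.\<close>

definition lambda_max :: "real mat \<Rightarrow> real" where
  "lambda_max A = Max (spectrum A)"

definition lambda_min :: "real mat \<Rightarrow> real" where
  "lambda_min A = Min (spectrum A)"

definition spec_rad :: "real mat \<Rightarrow> real" where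
  "spec_rad A = spectral_radius (map_mat complex_of_real A)"

definition vec_inf_norm :: "real vec \<Rightarrow> real" where
  "vec_inf_norm v = Max ((\<lambda>i. \<bar>vec_index v i\<bar>) ` {..<dim_vec v})"

definition mat_inf_norm :: "real mat \<Rightarrow> real" where
  "mat_inf_norm A =
     (SUP v\<in>{v \<in> carrier_vec (dim_col A). vec_inf_norm v = 1}. vec_inf_norm (A *\<^sub>v v))"

section \<open>Probabilistic notions\<close>

text \<open>\<open>X\<^sub>n = O\<^sub>P(r\<^sub>n)\<close> for \<open>X\<^sub>n\<close> defined on \<open>M\<^sub>n\<close>. The event \<open>A\<close> only avoids having to know that
  \<open>X\<^sub>n\<close> is measurable; for measurable \<open>X\<^sub>n\<close> one may take \<open>A = {\<bar>X\<^sub>n\<bar> \<le> C r\<^sub>n}\<close>,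
  which gives the usual definition.\<close>

definition bigo_prob :: "(nat \<Rightarrow> 'a measure) \<Rightarrow> (nat \<Rightarrow> 'a \<Rightarrow> real) \<Rightarrow> (nat \<Rightarrow> real) \<Rightarrow> bool" where
  "bigo_prob M X r \<longleftrightarrow>
     (\<forall>\<epsilon>>0. \<exists>C>0. \<forall>\<^sub>F n in sequentially.
        \<exists>A\<in>sets (M n). measure (M n) A \<ge> 1 - \<epsilon> \<and> (\<forall>\<omega>\<in>A. \<bar>X n \<omega>\<bar> \<le> C * r n))"

definition covariance :: "'a measure \<Rightarrow> ('a \<Rightarrow> real) \<Rightarrow> ('a \<Rightarrow> real) \<Rightarrow> real" where
  "covariance M U V =
     integral\<^sup>L M (\<lambda>\<omega>. (U \<omega> - integral\<^sup>L M U) * (V \<omega> - integral\<^sup>L M V))"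

text \<open>Covariance matrix of \<open>(e\<^sub>1, \<dots>, e\<^sub>q)\<close>.\<close>

definition cov_mat :: "'a measure \<Rightarrow> nat \<Rightarrow> (int \<Rightarrow> 'a \<Rightarrow> real) \<Rightarrow> real mat" where
  "cov_mat M q e = mat q q (\<lambda>(k, l). covariance M (e (int k + 1)) (e (int l + 1)))"

text \<open>\<open>e\<close> is the stationary AR(1) process with innovations \<open>Z\<close>. Almost surely, the second equation
  implies the first one; it is what singles out the stationary solution.\<close>

definition stationary_ar1 ::
  "'a measure \<Rightarrow> real \<Rightarrow> (int \<Rightarrow> 'a \<Rightarrow> real) \<Rightarrow> (int \<Rightarrow> 'a \<Rightarrow> real) \<Rightarrow> bool" where
  "stationary_ar1 M \<phi> Z e \<longleftrightarrow>
     (\<forall>t. e t \<in> borel_measurable M \<and>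
          (AE \<omega> in M. e t \<omega> - \<phi> * e (t - 1) \<omega> = Z t \<omega>) \<and>
          (AE \<omega> in M. (\<lambda>j. \<phi> ^ j * Z (t - int j) \<omega>) sums e t \<omega>))"

section \<open>The linear model and the estimators\<close>

definition error_mat :: "nat \<Rightarrow> nat \<Rightarrow> (nat \<Rightarrow> int \<Rightarrow> 'a \<Rightarrow> real) \<Rightarrow> 'a \<Rightarrow> real mat" where
  "error_mat n q e \<omega> = mat n q (\<lambda>(i, t). e (i + 1) (int t + 1) \<omega>)"

definition residual_proj :: "real mat \<Rightarrow> real mat" where
  "residual_proj X = 1\<^sub>m (dim_row X) - X * mat_inv (X\<^sup>T * X) * X\<^sup>T"

definition residuals :: "real mat \<Rightarrow> real mat \<Rightarrow> real mat" where
  "residuals X Y = residual_proj X * Y"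

lemma residuals_linear_model:
  assumes X: "X \<in> carrier_mat n p" and B: "B \<in> carrier_mat p q" and E: "E \<in> carrier_mat n q"
    and inv: "invertible_mat (X\<^sup>T * X)"
  shows "residuals X (X * B + E) = residual_proj X * E"
proof -
  let ?G = "mat_inv (X\<^sup>T * X)"
  have XT: "X\<^sup>T \<in> carrier_mat p n" and XX: "X\<^sup>T * X \<in> carrier_mat p p" using X by auto
  note G = mat_inv[OF XX inv]
  have H: "X * ?G \<in> carrier_mat n p" using X G(1) by auto
  have HT: "X * ?G * X\<^sup>T \<in> carrier_mat n n" using H XT by auto
  have P: "residual_proj X = 1\<^sub>m n - X * ?G * X\<^sup>T" using X by (simp add: residual_proj_def)
  have Pc: "residual_proj X \<in> carrier_mat n n" unfolding P using HT by (rule minus_carrier_mat)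
  have "X * ?G * X\<^sup>T * X = X * (?G * (X\<^sup>T * X))"
    using assoc_mult_mat[OF H XT X] assoc_mult_mat[OF X G(1) XX] by simp
  also have "\<dots> = X" using X G(3) by simp
  finally have "residual_proj X * X = 0\<^sub>m n p"
    unfolding P using minus_mult_distrib_mat[OF one_carrier_mat HT X] X by simp
  hence "residual_proj X * (X * B) = 0\<^sub>m n q"
    using assoc_mult_mat[OF Pc X B] B by simp
  moreover have "residual_proj X * (X * B + E) = residual_proj X * (X * B) + residual_proj X * E"
    by (rule mult_add_distrib_mat[OF Pc _ E]) (use X B in auto)
  ultimately show ?thesis
    unfolding residuals_def using Pc E by simp
qed

text \<open>Argument: the residual matrix.\<close>

definition phi_hat :: "real mat \<Rightarrow> real" where
  "phi_hat R =
     (\<Sum>i<dim_row R. \<Sum>l=1..<dim_col R. R $$ (i, l) * R $$ (i, l - 1)) /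
     (\<Sum>i<dim_row R. \<Sum>l<dim_col R - 1. (R $$ (i, l))\<^sup>2)"

definition Sigma_hat :: "real mat \<Rightarrow> real mat" where
  "Sigma_hat R = mat (dim_col R) (dim_col R)
     (\<lambda>(k, l). phi_hat R ^ nat \<bar>int k - int l\<bar> / (1 - (phi_hat R)\<^sup>2))"

end

theory Submission
  imports Defs
begin

text \<open>Up to the factor \<open>\<sigma>\<^sup>2\<close>, the matrix \<open>\<Sigma>\<close> has entries \<open>\<phi>\<^bsup>|k - l|\<^esup> / (1 - \<phi>\<^sup>2)\<close>, and its inverse is an
  explicit tridiagonal matrix. Gershgorin's theorem for the inverse gives (A7) and (A8). The inverse is
  Lipschitz in \<open>\<phi>\<close> for row sums, which reduces (A9) to the rate of \<open>\<phi>\<^sub>1\<close>-hat; (A10) follows in the same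
  way from \<open>S - S' = S (T' - T) S'\<close> for correlation matrices \<open>S, S'\<close> with inverses \<open>T, T'\<close>.

  Let \<open>\<Pi>\<close> be the residual projection and write \<open>E\<^sub>t\<close>, \<open>Z\<^sub>t\<close> for the vectors over the \<open>n\<close> rows. The
  deviation of the estimator from \<open>\<phi>\<close> is \<open>N / D\<close> with \<open>N = \<Sum>\<^sub>t \<langle>E\<^sub>t\<^sub>-\<^sub>1, \<Pi> Z\<^sub>t\<rangle>\<close> and \<open>D = \<Sum>\<^sub>t |\<Pi> E\<^sub>t|\<^sup>2\<close>. The products
  \<open>E\<^bsub>i,t-1\<^esub> Z\<^bsub>j,t\<^esub>\<close> are pairwise orthogonal, so \<open>N\<close> has second moment \<open>O(nq)\<close>. No variance of \<open>D\<close> is needed: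
  since \<open>\<Pi> E\<^sub>t = \<phi> \<Pi> E\<^sub>t\<^sub>-\<^sub>1 + \<Pi> Z\<^sub>t\<close>, one has
  \<open>D \<ge> 2 \<phi> \<Sum>\<^sub>t \<langle>E\<^sub>t\<^sub>-\<^sub>1, \<Pi> Z\<^sub>t\<rangle> + \<Sum>\<^sub>t |Z\<^sub>t|\<^sup>2 - \<Sum>\<^sub>t |(1 - \<Pi>) Z\<^sub>t|\<^sup>2\<close>,
  where the first sum is of the same kind as \<open>N\<close>, the second one concentrates around \<open>n (q - 1) \<sigma>\<^sup>2\<close>,
  and the last one has expectation \<open>p (q - 1) \<sigma>\<^sup>2\<close>.\<close>

section \<open>Eigenvalues, norms and row sums\<close>

text \<open>Gershgorin's disc theorem, from the row in which the eigenvector has its largest entry.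
  The field is general because the real case bounds the eigenvalues of the precision matrix, while
  the complex case bounds \<open>spec_rad\<close>.\<close>

lemma eigenvalue_gershgorin:
  fixes A :: "'a :: real_normed_field mat"
  assumes A: "A \<in> carrier_mat n n" and "eigenvalue A k"
  shows "\<exists>i<n. norm (k - A $$ (i, i)) \<le> (\<Sum>j\<in>{..<n} - {i}. norm (A $$ (i, j)))"
proof -
  obtain v where v: "v \<in> carrier_vec n" "v \<noteq> 0\<^sub>v n" and Av: "A *\<^sub>v v = k \<cdot>\<^sub>v v"
    using assms by (auto simp: eigenvalue_def eigenvector_def)
  obtain m where m: "m < n" "v $ m \<noteq> 0" using v by (metis carrier_vecD eq_vecI index_zero_vec)
  define N where "N = Max ((\<lambda>i. norm (v $ i)) ` {..<n})"
  have le: "norm (v $ j) \<le> N" if "j < n" for j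
    unfolding N_def using that by (intro Max_ge) auto
  have "N \<in> (\<lambda>i. norm (v $ i)) ` {..<n}"
    unfolding N_def using m by (intro Max_in) auto
  then obtain i where i: "i < n" "norm (v $ i) = N" by auto
  have pos: "0 < N" using le[OF m(1)] m(2) by (meson less_le_trans zero_less_norm_iff)
  have "(\<Sum>j<n. A $$ (i, j) * v $ j) = k * v $ i"
    using arg_cong[OF Av, of "\<lambda>w. w $ i"] A v(1) i(1)
    by (simp add: scalar_prod_def lessThan_atLeast0)
  moreover have "(\<Sum>j<n. A $$ (i, j) * v $ j) =
      A $$ (i, i) * v $ i + (\<Sum>j\<in>{..<n} - {i}. A $$ (i, j) * v $ j)"
    using i(1) by (simp add: sum.remove)
  ultimately have "(k - A $$ (i, i)) * v $ i = (\<Sum>j\<in>{..<n} - {i}. A $$ (i, j) * v $ j)"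
    by (metis add_diff_cancel_left' left_diff_distrib)
  then have "norm (k - A $$ (i, i)) * N = norm (\<Sum>j\<in>{..<n} - {i}. A $$ (i, j) * v $ j)"
    using i(2) norm_mult[of "k - A $$ (i, i)" "v $ i"] by simp
  also have "\<dots> \<le> (\<Sum>j\<in>{..<n} - {i}. norm (A $$ (i, j)) * N)"
    by (intro sum_norm_le) (auto simp: norm_mult intro!: mult_left_mono le)
  also have "\<dots> = (\<Sum>j\<in>{..<n} - {i}. norm (A $$ (i, j))) * N"
    by (simp add: sum_distrib_right)
  finally show ?thesis using pos i(1) by (auto simp: mult_le_cancel_right)
qed

text \<open>A bound on the norm induced by the maximum norm, in a form that multiplies and scales
  without suprema. It controls both \<open>mat_inf_norm\<close> and \<open>spec_rad\<close>, so the
  perturbation estimates below are all made with it.\<close>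

definition row_sums_le :: "real mat \<Rightarrow> real \<Rightarrow> bool" where
  "row_sums_le A c \<longleftrightarrow> (\<forall>i<dim_row A. (\<Sum>j<dim_col A. \<bar>A $$ (i, j)\<bar>) \<le> c)"

lemma row_sums_le_mult:
  assumes A: "A \<in> carrier_mat m n" and B: "B \<in> carrier_mat n l"
    and a: "row_sums_le A a" and b: "row_sums_le B b" and "0 \<le> b"
  shows "row_sums_le (A * B) (a * b)"
  unfolding row_sums_le_def
proof (intro allI impI)
  fix i assume "i < dim_row (A * B)"
  then have i: "i < m" using A by simp
  have "(\<Sum>j<l. \<bar>(A * B) $$ (i, j)\<bar>) \<le> (\<Sum>j<l. \<Sum>k<n. \<bar>A $$ (i, k)\<bar> * \<bar>B $$ (k, j)\<bar>)"
  proof (rule sum_mono)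
    fix j assume "j \<in> {..<l}"
    then have "(A * B) $$ (i, j) = (\<Sum>k<n. A $$ (i, k) * B $$ (k, j))"
      using A B i by (simp add: scalar_prod_def lessThan_atLeast0)
    then show "\<bar>(A * B) $$ (i, j)\<bar> \<le> (\<Sum>k<n. \<bar>A $$ (i, k)\<bar> * \<bar>B $$ (k, j)\<bar>)"
      using sum_abs[of "\<lambda>k. A $$ (i, k) * B $$ (k, j)" "{..<n}"] by (simp add: abs_mult)
  qed
  also have "\<dots> = (\<Sum>k<n. \<bar>A $$ (i, k)\<bar> * (\<Sum>j<l. \<bar>B $$ (k, j)\<bar>))"
    by (subst sum.swap) (simp add: sum_distrib_left)
  also have "\<dots> \<le> (\<Sum>k<n. \<bar>A $$ (i, k)\<bar> * b)"
    using b B by (intro sum_mono mult_left_mono) (auto simp: row_sums_le_def)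
  also have "\<dots> = (\<Sum>k<n. \<bar>A $$ (i, k)\<bar>) * b" by (simp add: sum_distrib_right)
  also have "\<dots> \<le> a * b"
    using a A i \<open>0 \<le> b\<close> by (intro mult_right_mono) (auto simp: row_sums_le_def)
  finally show "(\<Sum>j<dim_col (A * B). \<bar>(A * B) $$ (i, j)\<bar>) \<le> a * b" using B by simp
qed

lemma row_sums_le_smult:
  "row_sums_le A c \<Longrightarrow> 0 \<le> s \<Longrightarrow> row_sums_le (s \<cdot>\<^sub>m A) (s * c)"
  by (auto simp: row_sums_le_def abs_mult mult_left_mono simp flip: sum_distrib_left)

lemma mat_inf_norm_abs_le:
  assumes A: "A \<in> carrier_mat n n" and n: "0 < n" and c: "row_sums_le A c"
  shows "\<bar>mat_inf_norm A\<bar> \<le> c"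
proof -
  let ?V = "{v \<in> carrier_vec n. vec_inf_norm v = 1}"
  have norm_bounds: "0 \<le> vec_inf_norm (A *\<^sub>v v) \<and> vec_inf_norm (A *\<^sub>v v) \<le> c" if v: "v \<in> ?V" for v
  proof -
    have v1: "\<bar>v $ j\<bar> \<le> 1" if "j < n" for j
    proof -
      have "\<bar>v $ j\<bar> \<le> vec_inf_norm v"
        unfolding vec_inf_norm_def using v that by (intro Max_ge) auto
      then show ?thesis using v by simp
    qed
    have le: "\<bar>(A *\<^sub>v v) $ i\<bar> \<le> c" if i: "i < n" for i
    proof -
      have "(A *\<^sub>v v) $ i = (\<Sum>j<n. A $$ (i, j) * v $ j)"
        using A v i by (auto simp: scalar_prod_def lessThan_atLeast0)
      also have "\<bar>\<dots>\<bar> \<le> (\<Sum>j<n. \<bar>A $$ (i, j)\<bar> * \<bar>v $ j\<bar>)"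
        using sum_abs[of "\<lambda>j. A $$ (i, j) * v $ j" "{..<n}"] by (simp add: abs_mult)
      also have "\<dots> \<le> (\<Sum>j<n. \<bar>A $$ (i, j)\<bar> * 1)"
        using v1 by (intro sum_mono mult_left_mono) auto
      also have "\<dots> \<le> c" using c A i by (simp add: row_sums_le_def)
      finally show ?thesis .
    qed
    have "vec_inf_norm (A *\<^sub>v v) \<le> c"
      unfolding vec_inf_norm_def using A n le by (subst Max_le_iff) auto
    moreover have "\<bar>(A *\<^sub>v v) $ 0\<bar> \<le> vec_inf_norm (A *\<^sub>v v)"
      unfolding vec_inf_norm_def using A n by (intro Max_ge) auto
    ultimately show ?thesis by linarith
  qed
  \<comment> \<open>The all-ones vector shows that the unit sphere is nonempty, so the supremum is
    meaningful; it also witnesses that the supremum is nonnegative.\<close>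
  have one: "vec n (\<lambda>_. 1) \<in> ?V"
  proof -
    have "(\<lambda>i. \<bar>vec n (\<lambda>_. 1 :: real) $ i\<bar>) ` {..<n} = {1}" using n by auto
    then show ?thesis by (simp add: vec_inf_norm_def)
  qed
  have "mat_inf_norm A = (SUP v\<in>?V. vec_inf_norm (A *\<^sub>v v))"
    using A by (simp add: mat_inf_norm_def)
  moreover have "(SUP v\<in>?V. vec_inf_norm (A *\<^sub>v v)) \<le> c"
    using one norm_bounds by (intro cSUP_least) blast+
  moreover have "0 \<le> (SUP v\<in>?V. vec_inf_norm (A *\<^sub>v v))"
    using norm_bounds[OF one] norm_bounds by (intro cSUP_upper2[OF _ one] bdd_aboveI2[of _ _ c]) blast+
  ultimately show ?thesis by simp
qed

text \<open>The Gershgorin disc of a row lies in the disc around 0 whose radius is the absolute row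
  sum.\<close>

lemma spec_rad_abs_le:
  assumes A: "A \<in> carrier_mat n n" and n: "0 < n" and c: "row_sums_le A c"
  shows "\<bar>spec_rad A\<bar> \<le> c"
proof -
  let ?C = "map_mat complex_of_real A"
  have C: "?C \<in> carrier_mat n n" using A by simp
  obtain k where k: "eigenvalue ?C k" and rad: "spec_rad A = norm k"
    using spectral_radius_mem_max(1)[OF C n] by (auto simp: spec_rad_def spectrum_def)
  obtain i where i: "i < n" and le: "norm (k - ?C $$ (i, i)) \<le> (\<Sum>j\<in>{..<n} - {i}. norm (?C $$ (i, j)))"
    using eigenvalue_gershgorin[OF C k] by blast
  have "norm k \<le> norm (?C $$ (i, i)) + norm (k - ?C $$ (i, i))"
    using norm_triangle_ineq[of "?C $$ (i, i)" "k - ?C $$ (i, i)"] by simp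
  also have "\<dots> \<le> norm (?C $$ (i, i)) + (\<Sum>j\<in>{..<n} - {i}. norm (?C $$ (i, j)))"
    using le by simp
  also have "\<dots> = (\<Sum>j<n. norm (?C $$ (i, j)))"
    using i by (simp add: sum.remove[of "{..<n}" i])
  also have "\<dots> = (\<Sum>j<n. \<bar>A $$ (i, j)\<bar>)"
    using A i by (intro sum.cong) auto
  also have "\<dots> \<le> c" using c A i by (simp add: row_sums_le_def)
  finally show ?thesis using rad by simp
qed

text \<open>\<open>lambda_max\<close> and \<open>lambda_min\<close> are extrema of a set of real
  eigenvalues and carry no information if that set is empty. A complex eigenvalue of a real
  symmetric matrix is real, and the real or the imaginary part of its eigenvector is a real
  eigenvector.\<close>

lemma symmetric_real_spectrum_nonempty:
  fixes A :: "real mat"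
  assumes A: "A \<in> carrier_mat n n" and n: "0 < n"
    and sym: "\<And>i j. i < n \<Longrightarrow> j < n \<Longrightarrow> A $$ (i, j) = A $$ (j, i)"
  shows "spectrum A \<noteq> {}"
proof -
  let ?C = "map_mat complex_of_real A"
  have C: "?C \<in> carrier_mat n n" using A by simp
  obtain k where "eigenvalue ?C k"
    using spectrum_non_empty[OF C n] by (auto simp: spectrum_def)
  then obtain v where v: "v \<in> carrier_vec n" "v \<noteq> 0\<^sub>v n" and Cv: "?C *\<^sub>v v = k \<cdot>\<^sub>v v"
    using A by (auto simp: eigenvalue_def eigenvector_def)
  have row: "(\<Sum>j<n. complex_of_real (A $$ (i, j)) * v $ j) = k * v $ i" if "i < n" for i
    using arg_cong[OF Cv, of "\<lambda>w. w $ i"] A v(1) that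
    by (simp add: scalar_prod_def lessThan_atLeast0)
  \<comment> \<open>\<open>s\<close> is the Hermitian form at \<open>v\<close> and \<open>w\<close>
    the squared length of \<open>v\<close>. Symmetry makes \<open>s\<close> real, and
    \<open>s = k * w\<close> with \<open>w\<close> nonzero then makes \<open>k\<close> real.\<close>
  define s where "s = (\<Sum>i<n. \<Sum>j<n. cnj (v $ i) * complex_of_real (A $$ (i, j)) * v $ j)"
  define w where "w = (\<Sum>i<n. (cmod (v $ i))\<^sup>2)"
  have "cnj s = (\<Sum>i<n. \<Sum>j<n. v $ i * complex_of_real (A $$ (i, j)) * cnj (v $ j))"
    by (simp add: s_def)
  also have "\<dots> = (\<Sum>j<n. \<Sum>i<n. v $ i * complex_of_real (A $$ (i, j)) * cnj (v $ j))"
    by (rule sum.swap)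
  also have "\<dots> = s"
    unfolding s_def by (intro sum.cong refl) (simp add: sym mult_ac)
  finally have s_real: "cnj s = s" .
  have "s = (\<Sum>i<n. cnj (v $ i) * (k * v $ i))"
    unfolding s_def by (intro sum.cong refl) (simp add: row[symmetric] sum_distrib_left mult.assoc)
  also have "\<dots> = k * complex_of_real w"
    unfolding w_def of_real_sum sum_distrib_left
    by (intro sum.cong refl) (simp only: complex_norm_square mult_ac)
  finally have s_k: "s = k * complex_of_real w" .
  obtain m where m: "m < n" "v $ m \<noteq> 0" using v by (metis carrier_vecD eq_vecI index_zero_vec)
  have "0 < (cmod (v $ m))\<^sup>2" using m by simp
  also have "\<dots> \<le> w" unfolding w_def using m(1) by (intro member_le_sum) auto
  finally have "w \<noteq> 0" by simp
  then have "cnj k = k" using s_real unfolding s_k by simp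
  then obtain r where r: "k = complex_of_real r" by (metis Reals_cases Reals_cnj_iff)
  \<comment> \<open>\<open>f\<close> stands for \<open>Re\<close> or \<open>Im\<close>, whichever is
    nonzero at the coordinate \<open>m\<close>. Applied entrywise it preserves the eigenvector
    equation, since \<open>A\<close> and the eigenvalue are real.\<close>
  have eigen: "spectrum A \<noteq> {}" if f: "\<And>z. f (k * z) = r * f z" "f (v $ m) \<noteq> 0"
      "\<And>g. f (\<Sum>j<n. g j) = (\<Sum>j<n. f (g j))" "\<And>a z. f (complex_of_real a * z) = a * f z"
    for f :: "complex \<Rightarrow> real"
  proof -
    let ?u = "vec n (\<lambda>i. f (v $ i))"
    have "A *\<^sub>v ?u = r \<cdot>\<^sub>v ?u"
    proof (rule eq_vecI)
      fix i assume "i < dim_vec (r \<cdot>\<^sub>v ?u)"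
      then have i: "i < n" by simp
      have "(A *\<^sub>v ?u) $ i = (\<Sum>j<n. A $$ (i, j) * f (v $ j))"
        using A i by (simp add: scalar_prod_def lessThan_atLeast0)
      also have "\<dots> = f (\<Sum>j<n. complex_of_real (A $$ (i, j)) * v $ j)" by (simp add: f)
      also have "\<dots> = r * f (v $ i)" using row[OF i] f(1) by simp
      finally show "(A *\<^sub>v ?u) $ i = (r \<cdot>\<^sub>v ?u) $ i" using i by simp
    qed (use A in simp)
    moreover have "?u \<noteq> 0\<^sub>v n"
    proof
      assume "?u = 0\<^sub>v n"
      then have "?u $ m = 0" using m(1) by simp
      then show False using m(1) f(2) by simp
    qed
    ultimately have "eigenvector A ?u r" using A by (simp add: eigenvector_def)
    then show ?thesis by (auto simp: spectrum_def eigenvalue_def)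
  qed
  have "Re (v $ m) \<noteq> 0 \<or> Im (v $ m) \<noteq> 0" using m(2) by (simp add: complex_eq_iff)
  then show ?thesis using eigen[of Re] eigen[of Im] r by auto
qed

lemma mat_inv_eqI:
  fixes A :: "'a :: field mat"
  assumes A: "A \<in> carrier_mat n n" and B: "B \<in> carrier_mat n n" and AB: "A * B = 1\<^sub>m n"
  shows "mat_inv A = B"
proof -
  have BA: "B * A = 1\<^sub>m n" by (rule mat_mult_left_right_inverse[OF A B AB])
  then have "invertible_mat A"
    using A B AB unfolding invertible_mat_def inverts_mat_def by auto
  note inv = mat_inv[OF A this]
  have "mat_inv A = (B * A) * mat_inv A" unfolding BA using inv(1) by simp
  also have "\<dots> = B * (A * mat_inv A)" by (rule assoc_mult_mat[OF B A inv(1)])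
  also have "\<dots> = B" unfolding inv(2) using B by simp
  finally show ?thesis .
qed

section \<open>The AR(1) correlation matrix and its inverse\<close>

text \<open>The diagonal is \<open>1 / (1 - \<phi>\<^sup>2)\<close>: this is the covariance matrix
  of a row for innovation variance 1, and \<open>Sigma_hat\<close> is the same matrix at the
  estimated parameter.\<close>

definition ar1_corr :: "nat \<Rightarrow> real \<Rightarrow> real mat" where
  "ar1_corr d \<phi> = mat d d (\<lambda>(k, l). \<phi> ^ nat \<bar>int k - int l\<bar> / (1 - \<phi>\<^sup>2))"

text \<open>For \<open>d\<close> at least 2 this is the matrix of the quadratic form
  \<open>(1 - \<phi>\<^sup>2) x\<^sub>0\<^sup>2\<close> plus the sum of the
  \<open>(x\<^sub>k - \<phi> x\<^sub>k\<^sub>-\<^sub>1)\<^sup>2\<close>, which is the exponent of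
  the Gaussian AR(1) density up to a factor. This explains the two corner entries 1.\<close>

definition ar1_prec :: "nat \<Rightarrow> real \<Rightarrow> real mat" where
  "ar1_prec d \<phi> = mat d d (\<lambda>(k, l).
     if k = l then (if k = 0 \<or> Suc k = d then 1 else 1 + \<phi>\<^sup>2)
     else if k = Suc l \<or> l = Suc k then - \<phi> else 0)"

lemma ar1_corr_carrier [simp]: "ar1_corr d \<phi> \<in> carrier_mat d d"
  by (simp add: ar1_corr_def)

lemma ar1_prec_carrier [simp]: "ar1_prec d \<phi> \<in> carrier_mat d d"
  by (simp add: ar1_prec_def)

lemma sum_neighbours:
  fixes g :: "nat \<Rightarrow> real"
  assumes "k < d"
  shows "(\<Sum>m<d. if m \<noteq> k \<and> (k = Suc m \<or> m = Suc k) then g m else 0) =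
    (if 0 < k then g (k - 1) else 0) + (if Suc k < d then g (Suc k) else 0)"
proof -
  have "(\<Sum>m<d. if m \<noteq> k \<and> (k = Suc m \<or> m = Suc k) then g m else 0) =
    (\<Sum>m<d. (if m = k - 1 then if 0 < k then g m else 0 else 0) + (if m = Suc k then g m else 0))"
    by (rule sum.cong) auto
  also have "\<dots> = (if 0 < k then g (k - 1) else 0) + (if Suc k < d then g (Suc k) else 0)"
    unfolding sum.distrib using assms by (simp add: sum.delta)
  finally show ?thesis .
qed

text \<open>As a function of \<open>m\<close>, column \<open>l\<close> of the second factor is a
  multiple of \<open>\<phi> ^ \<bar>m - l\<bar>\<close>. Away from \<open>l\<close> this solves the
  three-term recurrence given by the rows of the first factor; at \<open>l\<close> the kink leaves
  \<open>1 - \<phi>\<^sup>2\<close>, which the normalisation cancels. In the corner rows the missing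
  neighbour is compensated by the smaller diagonal entry.\<close>

lemma ar1_prec_mult_corr:
  assumes d: "2 \<le> d" and phi: "\<phi>\<^sup>2 < 1"
  shows "ar1_prec d \<phi> * ar1_corr d \<phi> = 1\<^sub>m d"
proof (rule eq_matI)
  fix k l assume "k < dim_row (1\<^sub>m d :: real mat)" "l < dim_col (1\<^sub>m d :: real mat)"
  then have k: "k < d" and l: "l < d" by simp_all
  define f where "f m = \<phi> ^ nat \<bar>int m - int l\<bar> / (1 - \<phi>\<^sup>2)" for m :: nat
  let ?c = "if k = 0 \<or> Suc k = d then 1 else 1 + \<phi>\<^sup>2"
  have "(ar1_prec d \<phi> * ar1_corr d \<phi>) $$ (k, l) =
      (\<Sum>m<d. ar1_prec d \<phi> $$ (k, m) * f m)"
    using k l carrier_matD[OF ar1_prec_carrier] carrier_matD[OF ar1_corr_carrier]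
    by (simp add: scalar_prod_def lessThan_atLeast0) (simp add: ar1_corr_def f_def)
  also have "\<dots> = (\<Sum>m<d. (if m = k then ?c * f m else 0)
        + (if m \<noteq> k \<and> (k = Suc m \<or> m = Suc k) then - \<phi> * f m else 0))"
    using k by (intro sum.cong refl) (auto simp: ar1_prec_def)
  also have "\<dots> = ?c * f k + ((if 0 < k then - \<phi> * f (k - 1) else 0) + (if Suc k < d then - \<phi> * f (Suc k) else 0))"
    unfolding sum.distrib sum_neighbours[OF k] using k by (simp add: sum.delta)
  also have "\<dots> = (if k = l then 1 else 0)"
  proof -
    consider "k = l" | "k < l" | "l < k" by linarith
    then show ?thesis
    proof cases
      case 1
      have ne: "1 - \<phi>\<^sup>2 \<noteq> 0" using phi by simp
      have f: "f l = 1 / (1 - \<phi>\<^sup>2)" "f (Suc l) = \<phi> / (1 - \<phi>\<^sup>2)"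
        "0 < l \<Longrightarrow> f (l - Suc 0) = \<phi> / (1 - \<phi>\<^sup>2)"
        by (auto simp: f_def of_nat_diff)
      show ?thesis
      proof (cases "l = 0")
        case True
        then have f0: "f 0 = 1 / (1 - \<phi>\<^sup>2)" "f (Suc 0) = \<phi> / (1 - \<phi>\<^sup>2)" using f by simp_all
        have "f 0 - \<phi> * f (Suc 0) = 1"
          unfolding f0 using ne by (simp add: diff_divide_distrib[symmetric] power2_eq_square)
        then show ?thesis unfolding 1 using d True by simp
      next
        case False
        then show ?thesis
          unfolding 1 using ne l by (auto simp: f divide_simps) (auto simp: power2_eq_square algebra_simps)
      qed
    next
      case 2
      \<comment> \<open>With the distance written as \<open>Suc e\<close>, the entries involved have
        the exponents \<open>e\<close>, \<open>Suc e\<close> and \<open>Suc (Suc e)\<close>, free of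
        subtraction.\<close>
      then obtain e where e: "l = k + Suc e" using less_imp_Suc_add by auto
      have "f k = \<phi> ^ Suc e / (1 - \<phi>\<^sup>2)" "f (Suc k) = \<phi> ^ e / (1 - \<phi>\<^sup>2)"
        "0 < k \<Longrightarrow> f (k - 1) = \<phi> ^ Suc (Suc e) / (1 - \<phi>\<^sup>2)"
        unfolding f_def e by (simp_all add: of_nat_diff nat_add_distrib)
      then show ?thesis using 2 l by (auto simp: power2_eq_square algebra_simps add_divide_distrib)
    next
      case 3
      then obtain e where e: "k = l + Suc e" using less_imp_Suc_add by auto
      have "f k = \<phi> ^ Suc e / (1 - \<phi>\<^sup>2)" "f (Suc k) = \<phi> ^ Suc (Suc e) / (1 - \<phi>\<^sup>2)"
        "f (k - 1) = \<phi> ^ e / (1 - \<phi>\<^sup>2)"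
        unfolding f_def e by (simp_all add: of_nat_diff nat_add_distrib)
      then show ?thesis using 3 k by (auto simp: power2_eq_square algebra_simps add_divide_distrib)
    qed
  qed
  finally show "(ar1_prec d \<phi> * ar1_corr d \<phi>) $$ (k, l) = 1\<^sub>m d $$ (k, l)" using k l by simp
qed (simp_all add: ar1_prec_def ar1_corr_def)

lemma ar1_corr_mult_prec:
  assumes d: "2 \<le> d" and phi: "\<phi>\<^sup>2 < 1"
  shows "ar1_corr d \<phi> * ar1_prec d \<phi> = 1\<^sub>m d"
  by (rule mat_mult_left_right_inverse[OF _ _ ar1_prec_mult_corr[OF assms]]) simp_all

lemma mat_inv_smult_ar1_corr:
  assumes d: "2 \<le> d" and phi: "\<phi>\<^sup>2 < 1" and s: "s \<noteq> 0"
  shows "mat_inv (s \<cdot>\<^sub>m ar1_corr d \<phi>) = (1 / s) \<cdot>\<^sub>m ar1_prec d \<phi>"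
proof (rule mat_inv_eqI[of _ d])
  have S: "ar1_corr d \<phi> \<in> carrier_mat d d" and T: "ar1_prec d \<phi> \<in> carrier_mat d d" by simp_all
  have "s \<cdot>\<^sub>m ar1_corr d \<phi> * ((1 / s) \<cdot>\<^sub>m ar1_prec d \<phi>) = s \<cdot>\<^sub>m ((1 / s) \<cdot>\<^sub>m 1\<^sub>m d)"
    using mult_smult_assoc_mat[OF S smult_carrier_mat[OF T]] mult_smult_distrib[OF S T]
      ar1_corr_mult_prec[OF d phi] by simp
  also have "\<dots> = 1\<^sub>m d" using s by (intro eq_matI) auto
  finally show "s \<cdot>\<^sub>m ar1_corr d \<phi> * ((1 / s) \<cdot>\<^sub>m ar1_prec d \<phi>) = 1\<^sub>m d" .
qed simp_all

lemma ar1_prec_off_diagonal_sum: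
  assumes "i < d"
  shows "(\<Sum>j\<in>{..<d} - {i}. \<bar>ar1_prec d \<phi> $$ (i, j)\<bar>) =
    (if 0 < i then \<bar>\<phi>\<bar> else 0) + (if Suc i < d then \<bar>\<phi>\<bar> else 0)"
proof -
  have "(\<Sum>j\<in>{..<d} - {i}. \<bar>ar1_prec d \<phi> $$ (i, j)\<bar>) =
      (\<Sum>m<d. if m \<noteq> i \<and> (i = Suc m \<or> m = Suc i) then \<bar>\<phi>\<bar> else 0)"
    using assms by (intro sum.mono_neutral_cong_left) (auto simp: ar1_prec_def)
  then show ?thesis using sum_neighbours[OF assms, of "\<lambda>_. \<bar>\<phi>\<bar>"] by simp
qed

text \<open>In an interior row the Gershgorin interval is exactly from
  \<open>(1 - \<bar>\<phi>\<bar>)\<^sup>2\<close> to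
  \<open>(1 + \<bar>\<phi>\<bar>)\<^sup>2\<close>, up to the factor \<open>s\<close>. The interval
  \<open>1 \<plusminus> \<bar>\<phi>\<bar>\<close> of a corner row lies inside it because
  \<open>\<phi>\<^sup>2 \<le> \<bar>\<phi>\<bar>\<close>.\<close>

lemma ar1_prec_eigenvalue_bounds:
  assumes d: "2 \<le> d" and phi: "\<bar>\<phi>\<bar> < 1" and s: "0 < s" and k: "eigenvalue (s \<cdot>\<^sub>m ar1_prec d \<phi>) k"
  shows "s * (1 - \<bar>\<phi>\<bar>)\<^sup>2 \<le> k" "k \<le> s * (1 + \<bar>\<phi>\<bar>)\<^sup>2"
proof -
  let ?A = "s \<cdot>\<^sub>m ar1_prec d \<phi>"
  have "?A \<in> carrier_mat d d" by simp
  from eigenvalue_gershgorin[OF this k] obtain i where i: "i < d"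
    and le: "\<bar>k - ?A $$ (i, i)\<bar> \<le> (\<Sum>j\<in>{..<d} - {i}. \<bar>?A $$ (i, j)\<bar>)" by auto
  let ?c = "if i = 0 \<or> Suc i = d then 1 else 1 + \<phi>\<^sup>2"
  let ?o = "(if 0 < i then \<bar>\<phi>\<bar> else 0) + (if Suc i < d then \<bar>\<phi>\<bar> else 0)"
  have "(\<Sum>j\<in>{..<d} - {i}. \<bar>?A $$ (i, j)\<bar>) = s * (\<Sum>j\<in>{..<d} - {i}. \<bar>ar1_prec d \<phi> $$ (i, j)\<bar>)"
    unfolding sum_distrib_left using i s
    by (intro sum.cong refl) (simp add: abs_mult ar1_prec_def)
  moreover have "?A $$ (i, i) = s * ?c" using i by (simp add: ar1_prec_def)
  ultimately have *: "\<bar>k - s * ?c\<bar> \<le> s * ?o"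
    using le ar1_prec_off_diagonal_sum[OF i, of \<phi>] by simp
  have sq: "\<bar>\<phi>\<bar> * \<bar>\<phi>\<bar> \<le> \<bar>\<phi>\<bar>" using phi mult_left_le[of "\<bar>\<phi>\<bar>" "\<bar>\<phi>\<bar>"] by simp
  have "(1 - \<bar>\<phi>\<bar>)\<^sup>2 \<le> ?c - ?o" "?c + ?o \<le> (1 + \<bar>\<phi>\<bar>)\<^sup>2"
    using d i sq by (auto simp: power2_eq_square algebra_simps)
  then have "s * (1 - \<bar>\<phi>\<bar>)\<^sup>2 \<le> s * (?c - ?o)" "s * (?c + ?o) \<le> s * (1 + \<bar>\<phi>\<bar>)\<^sup>2"
    using s by (simp_all add: mult_left_mono)
  then show "s * (1 - \<bar>\<phi>\<bar>)\<^sup>2 \<le> k" "k \<le> s * (1 + \<bar>\<phi>\<bar>)\<^sup>2"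
    using * unfolding right_diff_distrib distrib_left by linarith+
qed

lemma ar1_prec_lambda_bounds:
  assumes d: "2 \<le> d" and phi: "\<bar>\<phi>\<bar> < 1" and s: "0 < s"
  shows "lambda_max (s \<cdot>\<^sub>m ar1_prec d \<phi>) \<le> s * (1 + \<bar>\<phi>\<bar>)\<^sup>2"
    and "s * (1 - \<bar>\<phi>\<bar>)\<^sup>2 \<le> lambda_min (s \<cdot>\<^sub>m ar1_prec d \<phi>)"
proof -
  let ?A = "s \<cdot>\<^sub>m ar1_prec d \<phi>"
  have A: "?A \<in> carrier_mat d d" by simp
  have fin: "finite (spectrum ?A)" by (rule card_finite_spectrum(1)[OF A])
  have ne: "spectrum ?A \<noteq> {}"
    using d by (intro symmetric_real_spectrum_nonempty[OF A]) (auto simp: ar1_prec_def)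
  show "lambda_max ?A \<le> s * (1 + \<bar>\<phi>\<bar>)\<^sup>2" "s * (1 - \<bar>\<phi>\<bar>)\<^sup>2 \<le> lambda_min ?A"
    using fin ne ar1_prec_eigenvalue_bounds[OF assms]
    by (auto simp: lambda_max_def lambda_min_def Max_le_iff Min_ge_iff spectrum_def)
qed

text \<open>The constant 4 is made of 2 for the diagonal, where
  \<open>\<phi>\<^sup>2 - \<psi>\<^sup>2\<close> is factored, and 1 for each of at most two
  neighbours. It is the same for every dimension.\<close>

lemma ar1_prec_diff_row_sums:
  assumes "\<bar>\<phi>\<bar> \<le> 1" "\<bar>\<psi>\<bar> \<le> 1"
  shows "row_sums_le (ar1_prec d \<phi> - ar1_prec d \<psi>) (4 * \<bar>\<phi> - \<psi>\<bar>)"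
  unfolding row_sums_le_def
proof (intro allI impI)
  let ?D = "ar1_prec d \<phi> - ar1_prec d \<psi>"
  fix i assume "i < dim_row ?D"
  then have i: "i < d" by (simp add: ar1_prec_def)
  have "\<bar>\<phi>\<^sup>2 - \<psi>\<^sup>2\<bar> = \<bar>\<phi> + \<psi>\<bar> * \<bar>\<phi> - \<psi>\<bar>"
    by (simp add: power2_eq_square square_diff_square_factored abs_mult)
  also have "\<dots> \<le> 2 * \<bar>\<phi> - \<psi>\<bar>" using assms by (intro mult_right_mono) auto
  finally have sq: "\<bar>\<phi>\<^sup>2 - \<psi>\<^sup>2\<bar> \<le> 2 * \<bar>\<phi> - \<psi>\<bar>" .
  have "(\<Sum>j<d. \<bar>?D $$ (i, j)\<bar>) \<le> (\<Sum>j<d. (if j = i then 2 * \<bar>\<phi> - \<psi>\<bar> else 0)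
      + (if j \<noteq> i \<and> (i = Suc j \<or> j = Suc i) then \<bar>\<phi> - \<psi>\<bar> else 0))"
    using i sq by (intro sum_mono) (auto simp: ar1_prec_def abs_minus_commute)
  also have "\<dots> \<le> 4 * \<bar>\<phi> - \<psi>\<bar>"
    unfolding sum.distrib sum_neighbours[OF i] using i by (auto simp: sum.delta)
  finally show "(\<Sum>j<dim_col ?D. \<bar>?D $$ (i, j)\<bar>) \<le> 4 * \<bar>\<phi> - \<psi>\<bar>" by (simp add: ar1_prec_def)
qed

text \<open>Distinct exponents select a part of the geometric series. The exponents will be the
  distances to a fixed index.\<close>

lemma sum_power_inj_le:
  fixes r :: real
  assumes "finite B" "inj_on h B" "0 \<le> r" "r < 1"
  shows "(\<Sum>l\<in>B. r ^ h l) \<le> 1 / (1 - r)"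
proof -
  have "(\<Sum>l\<in>B. r ^ h l) = (\<Sum>m\<in>h ` B. r ^ m)"
    using assms(2) by (simp add: sum.reindex)
  also have "\<dots> \<le> (\<Sum>m. r ^ m)"
    using assms by (intro sum_le_suminf summable_geometric) auto
  also have "\<dots> = 1 / (1 - r)" using assms by (intro suminf_geometric) auto
  finally show ?thesis .
qed

lemma ar1_corr_row_sums:
  assumes phi: "\<bar>\<phi>\<bar> \<le> r" and r: "r < 1"
  shows "row_sums_le (ar1_corr d \<phi>) (2 / ((1 - r) * (1 - r\<^sup>2)))"
  unfolding row_sums_le_def
proof (intro allI impI)
  fix i assume "i < dim_row (ar1_corr d \<phi>)"
  then have i: "i < d" by (simp add: ar1_corr_def)
  have r0: "0 \<le> r" using phi by linarith
  have r2: "\<phi>\<^sup>2 \<le> r\<^sup>2" using phi abs_le_square_iff[of \<phi> r] r0 by simp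
  have r1: "r\<^sup>2 < 1" using r r0 by (simp add: abs_square_less_1)
  have "(\<Sum>j<d. \<bar>ar1_corr d \<phi> $$ (i, j)\<bar>) = (\<Sum>j<d. \<bar>\<phi>\<bar> ^ nat \<bar>int i - int j\<bar> / (1 - \<phi>\<^sup>2))"
    using i r1 r2 by (intro sum.cong refl) (simp add: ar1_corr_def power_abs)
  also have "\<dots> \<le> (\<Sum>j<d. r ^ nat \<bar>int i - int j\<bar> / (1 - r\<^sup>2))"
    using phi r1 r2 r0 by (intro sum_mono frac_le power_mono zero_le_power) auto
  also have "\<dots> = (\<Sum>j<d. r ^ nat \<bar>int i - int j\<bar>) / (1 - r\<^sup>2)"
    by (simp add: sum_divide_distrib)
  also have "\<dots> \<le> (2 / (1 - r)) / (1 - r\<^sup>2)"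
  proof (rule divide_right_mono)
    \<comment> \<open>The distance to \<open>i\<close> is injective only on each side of
      \<open>i\<close>, hence two geometric series and the factor 2.\<close>
    have "{..<d} = {..i} \<union> {i<..<d}" using i by auto
    then have "(\<Sum>j<d. r ^ nat \<bar>int i - int j\<bar>) =
        (\<Sum>j\<le>i. r ^ nat \<bar>int i - int j\<bar>) + (\<Sum>j\<in>{i<..<d}. r ^ nat \<bar>int i - int j\<bar>)"
      by (simp add: sum.union_disjoint ivl_disj_int)
    also have "\<dots> \<le> 1 / (1 - r) + 1 / (1 - r)"
      using r r0 by (intro add_mono sum_power_inj_le) (auto simp: inj_on_def)
    finally show "(\<Sum>j<d. r ^ nat \<bar>int i - int j\<bar>) \<le> 2 / (1 - r)" by simp
  qed (use r1 in simp)
  finally show "(\<Sum>j<dim_col (ar1_corr d \<phi>). \<bar>ar1_corr d \<phi> $$ (i, j)\<bar>) \<le> 2 / ((1 - r) * (1 - r\<^sup>2))"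
    by (simp add: ar1_corr_def)
qed

text \<open>In the product \<open>S (T' - T) S'\<close> the middle factor contributes the Lipschitz
  constant 4 of the inverse, and each outer factor contributes its row sum bound. The result is
  uniform in the dimension.\<close>

lemma ar1_corr_diff_row_sums:
  assumes d: "2 \<le> d" and phi: "\<bar>\<phi>\<bar> \<le> r" and psi: "\<bar>\<psi>\<bar> \<le> r" and r: "r < 1"
  shows "row_sums_le (ar1_corr d \<phi> - ar1_corr d \<psi>) ((2 / ((1 - r) * (1 - r\<^sup>2)))\<^sup>2 * 4 * \<bar>\<phi> - \<psi>\<bar>)"
proof -
  let ?K = "2 / ((1 - r) * (1 - r\<^sup>2))"
  let ?S = "ar1_corr d" and ?T = "ar1_prec d"
  have r0: "0 \<le> r" using phi by linarith
  have r1: "r\<^sup>2 < 1" using r r0 by (simp add: abs_square_less_1)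
  have K: "0 \<le> ?K" using r r1 by simp
  have sq: "\<phi>\<^sup>2 < 1" "\<psi>\<^sup>2 < 1" using phi psi r by (auto simp: abs_square_less_1)
  have S: "?S \<phi> \<in> carrier_mat d d" "?S \<psi> \<in> carrier_mat d d"
    and T: "?T \<phi> \<in> carrier_mat d d" "?T \<psi> \<in> carrier_mat d d" by simp_all
  have ST: "?S \<phi> * ?T \<psi> \<in> carrier_mat d d" by (rule mult_carrier_mat[OF S(1) T(2)])
  have "?S \<phi> * (?T \<psi> - ?T \<phi>) * ?S \<psi> = (?S \<phi> * ?T \<psi> - 1\<^sub>m d) * ?S \<psi>"
    using ar1_corr_mult_prec[OF d sq(1)] mult_minus_distrib_mat[OF S(1) T(2,1)] by simp
  also have "\<dots> = ?S \<phi> * ?T \<psi> * ?S \<psi> - 1\<^sub>m d * ?S \<psi>"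
    by (rule minus_mult_distrib_mat[OF ST _ S(2)]) simp
  also have "?S \<phi> * ?T \<psi> * ?S \<psi> = ?S \<phi>"
    using assoc_mult_mat[OF S(1) T(2) S(2)] ar1_prec_mult_corr[OF d sq(2)] S by simp
  finally have eq: "?S \<phi> - ?S \<psi> = ?S \<phi> * (?T \<psi> - ?T \<phi>) * ?S \<psi>" using S by simp
  have dT: "?T \<psi> - ?T \<phi> \<in> carrier_mat d d" using T by (intro minus_carrier_mat)
  have "row_sums_le (?S \<phi> * (?T \<psi> - ?T \<phi>)) (?K * (4 * \<bar>\<psi> - \<phi>\<bar>))"
    using phi psi r by (intro row_sums_le_mult[OF S(1) dT] ar1_corr_row_sums ar1_prec_diff_row_sums) auto
  then have "row_sums_le (?S \<phi> * (?T \<psi> - ?T \<phi>) * ?S \<psi>) (?K * (4 * \<bar>\<psi> - \<phi>\<bar>) * ?K)"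
    using psi r K by (intro row_sums_le_mult[OF mult_carrier_mat[OF S(1) dT] S(2)] ar1_corr_row_sums) auto
  then show ?thesis unfolding eq by (simp add: power2_eq_square mult_ac abs_minus_commute)
qed

section \<open>Projections onto column spaces\<close>

definition hat_mat :: "real mat \<Rightarrow> real mat" where
  "hat_mat X = X * mat_inv (X\<^sup>T * X) * X\<^sup>T"

text \<open>The inverse \<open>G\<close> of the Gram matrix is symmetric because the Gram matrix is,
  which gives symmetry of the projection. Idempotence follows from the fact that the projection
  fixes \<open>X\<close>. The trace is cyclic: \<open>X * Q\<close> has the trace of
  \<open>Q * X\<close>, which is the identity of size \<open>p\<close>.\<close>

lemma
  assumes X: "X \<in> carrier_mat n p" and inv: "invertible_mat (X\<^sup>T * X)"
  shows hat_mat_carrier: "hat_mat X \<in> carrier_mat n n"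
    and hat_mat_symmetric: "(hat_mat X)\<^sup>T = hat_mat X"
    and hat_mat_idempotent: "hat_mat X * hat_mat X = hat_mat X"
    and hat_mat_trace: "(\<Sum>i<n. hat_mat X $$ (i, i)) = real p"
proof -
  define W where "W = X\<^sup>T * X"
  define G where "G = mat_inv W"
  have XT: "X\<^sup>T \<in> carrier_mat p n" and W: "W \<in> carrier_mat p p" using X by (auto simp: W_def)
  have G: "G \<in> carrier_mat p p" and WG: "W * G = 1\<^sub>m p" and GW: "G * W = 1\<^sub>m p"
    using mat_inv[OF W] inv by (simp_all add: G_def W_def)
  have hat: "hat_mat X = X * G * X\<^sup>T" by (simp add: hat_mat_def G_def W_def)
  have XG: "X * G \<in> carrier_mat n p" and GX: "G * X\<^sup>T \<in> carrier_mat p n" using X XT G by auto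
  show carrier: "hat_mat X \<in> carrier_mat n n" unfolding hat using XG XT by auto
  have "W\<^sup>T = W" using transpose_mult[OF XT X] by (simp add: W_def)
  then have "W * G\<^sup>T = 1\<^sub>m p"
    using transpose_mult[OF G W] GW by simp
  from mat_inv_eqI[OF W _ this] have GT: "G\<^sup>T = G" using G by (simp add: G_def)
  have hat2: "hat_mat X = X * (G * X\<^sup>T)"
    unfolding hat by (rule assoc_mult_mat[OF X G XT])
  have "(hat_mat X)\<^sup>T = (X\<^sup>T)\<^sup>T * (X * G)\<^sup>T"
    unfolding hat by (rule transpose_mult[OF XG XT])
  also have "\<dots> = hat_mat X" unfolding hat2 using transpose_mult[OF X G] GT by simp
  finally show "(hat_mat X)\<^sup>T = hat_mat X" .
  have "hat_mat X * X = X * G * W"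
    unfolding hat W_def by (rule assoc_mult_mat[OF XG XT X])
  also have "\<dots> = X" using assoc_mult_mat[OF X G W] GW X by simp
  finally have hX: "hat_mat X * X = X" .
  have "hat_mat X * hat_mat X = hat_mat X * X * (G * X\<^sup>T)"
    using assoc_mult_mat[OF carrier X GX] by (simp flip: hat2)
  also have "\<dots> = hat_mat X" unfolding hX by (rule hat2[symmetric])
  finally show "hat_mat X * hat_mat X = hat_mat X" .
  define Q where "Q = G * X\<^sup>T"
  have Q: "Q \<in> carrier_mat p n" using GX by (simp add: Q_def)
  have "(\<Sum>i<n. hat_mat X $$ (i, i)) = (\<Sum>i<n. \<Sum>k<p. X $$ (i, k) * Q $$ (k, i))"
    unfolding hat2 Q_def[symmetric] using X Q by (intro sum.cong refl) (simp add: scalar_prod_def lessThan_atLeast0)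
  also have "\<dots> = (\<Sum>k<p. \<Sum>i<n. Q $$ (k, i) * X $$ (i, k))"
    by (subst sum.swap) (simp add: mult.commute)
  also have "\<dots> = (\<Sum>k<p. (Q * X) $$ (k, k))"
    using X Q by (intro sum.cong refl) (simp add: scalar_prod_def lessThan_atLeast0)
  also have "Q * X = 1\<^sub>m p" unfolding Q_def using assoc_mult_mat[OF G XT X] GW by (simp add: W_def)
  finally show "(\<Sum>i<n. hat_mat X $$ (i, i)) = real p" by simp
qed

lemma sqrt_divide_self_powr: "0 < y \<Longrightarrow> sqrt y / y = y powr (-1/2)"
  using powr_minus[of y "1/2"] by (simp add: powr_half_sqrt sqrt_divide_self_eq)

text \<open>Orthogonal projections in coordinates, so that their entries can serve directly as
  weights of random sums. The projection onto the columns of \<open>X\<close> and its complement are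
  both instances.\<close>

locale symmetric_idempotent =
  fixes n :: nat and R :: "nat \<Rightarrow> nat \<Rightarrow> real"
  assumes sym: "i < n \<Longrightarrow> j < n \<Longrightarrow> R i j = R j i"
    and idem: "i < n \<Longrightarrow> j < n \<Longrightarrow> (\<Sum>k<n. R i k * R k j) = R i j"
begin

text \<open>\<open>\<langle>R u, R w\<rangle> = \<langle>u, R w\<rangle>\<close>: a product of two
  projected vectors becomes one double sum with the entries of \<open>R\<close> as weights.\<close>

lemma inner_product:
  "(\<Sum>i<n. (\<Sum>j<n. R i j * u j) * (\<Sum>k<n. R i k * w k)) = (\<Sum>j<n. \<Sum>k<n. R j k * (u j * w k))"
proof -
  have "(\<Sum>i<n. (\<Sum>j<n. R i j * u j) * (\<Sum>k<n. R i k * w k)) =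
      (\<Sum>i<n. \<Sum>j<n. \<Sum>k<n. R i j * u j * (R i k * w k))"
    by (simp add: sum_product)
  also have "\<dots> = (\<Sum>j<n. \<Sum>i<n. \<Sum>k<n. R i j * u j * (R i k * w k))"
    by (rule sum.swap)
  also have "\<dots> = (\<Sum>j<n. \<Sum>k<n. \<Sum>i<n. R i j * u j * (R i k * w k))"
    by (intro sum.cong refl sum.swap)
  also have "\<dots> = (\<Sum>j<n. \<Sum>k<n. R j k * (u j * w k))"
  proof (intro sum.cong refl)
    fix j k assume jk: "j \<in> {..<n}" "k \<in> {..<n}"
    have "(\<Sum>i<n. R i j * u j * (R i k * w k)) = (\<Sum>i<n. R j i * R i k) * (u j * w k)"
      unfolding sum_distrib_right using jk by (intro sum.cong refl) (simp add: sym[of _ j] mult_ac)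
    then show "(\<Sum>i<n. R i j * u j * (R i k * w k)) = R j k * (u j * w k)"
      using idem jk by simp
  qed
  finally show ?thesis .
qed

text \<open>The squared Frobenius norm of a projection is its trace. In this way the rank enters the
  second moments below.\<close>

lemma sum_squares_entries: "(\<Sum>i<n. \<Sum>j<n. (R i j)\<^sup>2) = (\<Sum>i<n. R i i)"
proof (rule sum.cong)
  fix i assume i: "i \<in> {..<n}"
  have "(\<Sum>j<n. (R i j)\<^sup>2) = (\<Sum>j<n. R i j * R j i)"
    using i by (intro sum.cong refl) (simp add: power2_eq_square sym[of _ i])
  then show "(\<Sum>j<n. (R i j)\<^sup>2) = R i i" using idem i by simp
qed simp

lemma complement: "symmetric_idempotent n (\<lambda>i j. (if i = j then 1 else 0) - R i j)"
proof
  fix i j assume ij: "i < n" "j < n"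
  show "(if i = j then 1 else 0) - R i j = (if j = i then 1 else 0) - R j i"
    using sym[OF ij] by simp
  have "((if i = k then 1 else 0) - R i k) * ((if k = j then 1 else 0) - R k j) =
      (if k = i then (if i = j then 1 else 0) - R i j else 0) - (if k = j then R i j else 0) + R i k * R k j"
    for k by (auto simp: algebra_simps)
  then show "(\<Sum>k<n. ((if i = k then 1 else 0) - R i k) * ((if k = j then 1 else 0) - R k j)) =
      (if i = j then 1 else 0) - R i j"
    using ij idem[OF ij] by (simp add: sum.distrib sum_subtractf)
qed

text \<open>Pythagoras for the decomposition of \<open>w\<close> into its two projections.\<close>

lemma complement_norm_square:
  "(\<Sum>i<n. (\<Sum>j<n. ((if i = j then 1 else 0) - R i j) * w j)\<^sup>2) =
   (\<Sum>i<n. (w i)\<^sup>2) - (\<Sum>i<n. (\<Sum>j<n. R i j * w j)\<^sup>2)"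
proof -
  have "(\<Sum>i<n. (\<Sum>j<n. ((if i = j then 1 else 0) - R i j) * w j)\<^sup>2) =
      (\<Sum>i<n. \<Sum>j<n. ((if i = j then 1 else 0) - R i j) * (w i * w j))"
    unfolding power2_eq_square by (rule symmetric_idempotent.inner_product[OF complement])
  also have "\<dots> = (\<Sum>i<n. \<Sum>j<n. (if j = i then w i * w j else 0) - R i j * (w i * w j))"
    by (intro sum.cong refl) (simp add: left_diff_distrib)
  also have "\<dots> = (\<Sum>i<n. w i * w i) - (\<Sum>i<n. \<Sum>j<n. R i j * (w i * w j))"
    by (simp add: sum_subtractf sum.delta)
  also have "(\<Sum>i<n. \<Sum>j<n. R i j * (w i * w j)) = (\<Sum>i<n. (\<Sum>j<n. R i j * w j)\<^sup>2)"
    unfolding power2_eq_square by (rule inner_product[symmetric])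
  finally show ?thesis by (simp add: power2_eq_square)
qed

end

lemma hat_mat_symmetric_idempotent:
  assumes X: "X \<in> carrier_mat n p" and inv: "invertible_mat (X\<^sup>T * X)"
  shows "symmetric_idempotent n (\<lambda>i j. hat_mat X $$ (i, j))"
proof
  note H = hat_mat_carrier[OF assms]
  fix i j assume ij: "i < n" "j < n"
  show "hat_mat X $$ (i, j) = hat_mat X $$ (j, i)"
    using arg_cong[OF hat_mat_symmetric[OF assms], of "\<lambda>A. A $$ (i, j)"] H ij by simp
  show "(\<Sum>k<n. hat_mat X $$ (i, k) * hat_mat X $$ (k, j)) = hat_mat X $$ (i, j)"
    using arg_cong[OF hat_mat_idempotent[OF assms], of "\<lambda>A. A $$ (i, j)"] H ij
    by (simp add: scalar_prod_def lessThan_atLeast0)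
qed

lemma residual_proj_entry:
  assumes "X \<in> carrier_mat n p" "invertible_mat (X\<^sup>T * X)" "i < n" "j < n"
  shows "residual_proj X $$ (i, j) = (if i = j then 1 else 0) - hat_mat X $$ (i, j)"
  using assms hat_mat_carrier[OF assms(1,2)]
  by (simp add: residual_proj_def hat_mat_def)

section \<open>Second moments\<close>

definition square_integrable :: "'a measure \<Rightarrow> ('a \<Rightarrow> real) \<Rightarrow> bool" where
  "square_integrable M U \<longleftrightarrow> U \<in> borel_measurable M \<and> integrable M (\<lambda>\<omega>. (U \<omega>)\<^sup>2)"

lemma square_integrable_mult_integrable:
  assumes "square_integrable M U" "square_integrable M V"
  shows "integrable M (\<lambda>\<omega>. U \<omega> * V \<omega>)"
proof (rule Bochner_Integration.integrable_bound)
  show "integrable M (\<lambda>\<omega>. (U \<omega>)\<^sup>2 + (V \<omega>)\<^sup>2)"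
    using assms by (auto simp: square_integrable_def)
  show "(\<lambda>\<omega>. U \<omega> * V \<omega>) \<in> borel_measurable M"
    using assms by (auto simp: square_integrable_def)
  have "\<bar>a * b\<bar> \<le> a\<^sup>2 + b\<^sup>2" for a b :: real
    using sum_squares_bound[of "\<bar>a\<bar>" "\<bar>b\<bar>"] mult_nonneg_nonneg[of "\<bar>a\<bar>" "\<bar>b\<bar>"]
    by (simp add: abs_mult del: zero_le_mult_iff mult_nonneg_nonneg)
  then show "AE \<omega> in M. norm (U \<omega> * V \<omega>) \<le> norm ((U \<omega>)\<^sup>2 + (V \<omega>)\<^sup>2)"
    by simp
qed

lemma square_integrable_cmult:
  "square_integrable M U \<Longrightarrow> square_integrable M (\<lambda>\<omega>. c * U \<omega>)"
  by (auto simp: square_integrable_def power_mult_distrib)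

lemma square_integrable_add:
  assumes "square_integrable M U" "square_integrable M V"
  shows "square_integrable M (\<lambda>\<omega>. U \<omega> + V \<omega>)"
  using assms square_integrable_mult_integrable[OF assms]
  by (auto simp: square_integrable_def power2_sum mult.assoc)

lemma square_integrable_sum:
  assumes "finite I" "\<And>i. i \<in> I \<Longrightarrow> square_integrable M (U i)"
  shows "square_integrable M (\<lambda>\<omega>. \<Sum>i\<in>I. U i \<omega>)"
  using assms
proof (induction I rule: finite_induct)
  case empty
  then show ?case by (simp add: square_integrable_def)
next
  case (insert x F)
  then show ?case using square_integrable_add[of M "U x"] by simp
qed

text \<open>Pythagoras in the space of square integrable functions. It is applied to products of
  errors and innovations that are orthogonal but dependent.\<close>

lemma integral_square_sum_orthogonal:
  fixes U :: "'i \<Rightarrow> 'a \<Rightarrow> real"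
  assumes "finite I" "\<And>i. i \<in> I \<Longrightarrow> square_integrable M (U i)"
    and "\<And>i j. i \<in> I \<Longrightarrow> j \<in> I \<Longrightarrow> i \<noteq> j \<Longrightarrow> integral\<^sup>L M (\<lambda>\<omega>. U i \<omega> * U j \<omega>) = 0"
  shows "integral\<^sup>L M (\<lambda>\<omega>. (\<Sum>i\<in>I. U i \<omega>)\<^sup>2) = (\<Sum>i\<in>I. integral\<^sup>L M (\<lambda>\<omega>. (U i \<omega>)\<^sup>2))"
  using assms
proof (induction I rule: finite_induct)
  case empty
  then show ?case by simp
next
  case (insert x F)
  have x: "square_integrable M (U x)" and F: "square_integrable M (\<lambda>\<omega>. \<Sum>i\<in>F. U i \<omega>)"
    using insert by (auto intro: square_integrable_sum)
  have xi: "integrable M (\<lambda>\<omega>. U x \<omega> * U i \<omega>)" if "i \<in> F" for i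
    using insert.prems(1) that by (auto intro: square_integrable_mult_integrable)
  have "integral\<^sup>L M (\<lambda>\<omega>. U x \<omega> * (\<Sum>i\<in>F. U i \<omega>)) = (\<Sum>i\<in>F. integral\<^sup>L M (\<lambda>\<omega>. U x \<omega> * U i \<omega>))"
    using xi by (simp add: sum_distrib_left Bochner_Integration.integral_sum)
  also have "\<dots> = 0" using insert by (intro sum.neutral) auto
  finally have cross: "integral\<^sup>L M (\<lambda>\<omega>. 2 * (U x \<omega> * (\<Sum>i\<in>F. U i \<omega>))) = 0" by simp
  have "integral\<^sup>L M (\<lambda>\<omega>. (\<Sum>i\<in>insert x F. U i \<omega>)\<^sup>2) = 
     integral\<^sup>L M (\<lambda>\<omega>. (U x \<omega>)\<^sup>2 + (\<Sum>i\<in>F. U i \<omega>)\<^sup>2 + 2 * (U x \<omega> * (\<Sum>i\<in>F. U i \<omega>)))"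
    using insert.hyps by (simp add: power2_sum mult.assoc)
  also have "\<dots> = integral\<^sup>L M (\<lambda>\<omega>. (U x \<omega>)\<^sup>2) + integral\<^sup>L M (\<lambda>\<omega>. (\<Sum>i\<in>F. U i \<omega>)\<^sup>2)"
    using x F cross square_integrable_mult_integrable[OF x F]
    by (subst Bochner_Integration.integral_add) (auto simp: square_integrable_def)
  finally show ?case using insert by simp
qed

lemma (in prob_space) square_integrable_imp_integrable:
  assumes "square_integrable M U"
  shows "integrable M U"
  using square_integrable_mult_integrable[OF assms, of "\<lambda>_. 1"] by (simp add: square_integrable_def)

text \<open>Markov's inequality for the square of \<open>U\<close>.\<close>

lemma (in prob_space) second_moment_tail:
  assumes "square_integrable M U" "c > 0"
  shows "prob {\<omega> \<in> space M. \<bar>U \<omega>\<bar> \<ge> c} \<le> expectation (\<lambda>\<omega>. (U \<omega>)\<^sup>2) / c\<^sup>2"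
proof -
  have [measurable]: "U \<in> borel_measurable M" using assms by (simp add: square_integrable_def)
  have "{\<omega> \<in> space M. \<bar>U \<omega>\<bar> \<ge> c} = {\<omega> \<in> space M. (U \<omega>)\<^sup>2 \<ge> c\<^sup>2}"
    using assms(2) abs_le_square_iff[of c] by simp
  then show ?thesis
    using integral_Markov_inequality_measure[of M "\<lambda>\<omega>. (U \<omega>)\<^sup>2" "{}" "c\<^sup>2"] assms
    by (auto simp: square_integrable_def)
qed

text \<open>With it the moments of the stationary process are read off from the AR(1) recursion alone: the
  series representation is only needed to see that they are bounded.\<close>

lemma bounded_solution_of_affine_recursion:
  fixes v :: "int \<Rightarrow> real"
  assumes "\<bar>r\<bar> < 1" and rec: "\<And>t. v t = r * v (t - 1) + s" and bound: "\<And>t. \<bar>v t\<bar> \<le> C"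
  shows "v t = s / (1 - r)"
proof -
  define g where "g = s / (1 - r)"
  have g: "s = g - r * g" 
  proof -
    have "1 - r \<noteq> 0" using assms(1) by auto
    then have "g * (1 - r) = s" by (simp add: g_def)
    then show ?thesis by (simp add: algebra_simps)
  qed
  \<comment> \<open>Going back in time, the deviation from the fixed point \<open>g\<close> picks up
    the factor \<open>r\<close> at each step while staying bounded, so it must vanish.\<close>
  have step: "v t - g = r ^ k * (v (t - int k) - g)" for k
  proof (induction k)
    case (Suc k)
    have "v (t - int k) - g = r * (v (t - int (Suc k)) - g)"
      using rec[of "t - int k"] unfolding g by (simp add: right_diff_distrib diff_diff_eq add.commute)
    then show ?case unfolding Suc by (simp only: power_Suc mult_ac)
  qed simp
  have le: "\<bar>v t - g\<bar> \<le> \<bar>r\<bar> ^ k * (C + \<bar>g\<bar>)" for k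
  proof -
    have "\<bar>v (t - int k) - g\<bar> \<le> C + \<bar>g\<bar>"
      by (rule order_trans[OF abs_triangle_ineq4]) (rule add_right_mono[OF bound])
    then show ?thesis
      unfolding step[of k] abs_mult power_abs by (rule mult_left_mono) simp
  qed
  have "(\<lambda>k. \<bar>r\<bar> ^ k) \<longlonglongrightarrow> 0"
    by (rule LIMSEQ_power_zero) (use assms(1) in simp)
  from tendsto_mult_right[OF this, of "C + \<bar>g\<bar>"]
  have "(\<lambda>k. \<bar>r\<bar> ^ k * (C + \<bar>g\<bar>)) \<longlonglongrightarrow> 0" by simp
  from LIMSEQ_le_const[OF this] have "\<bar>v t - g\<bar> \<le> 0" using le by blast
  then show ?thesis by (simp add: g_def)
qed

section \<open>Stationary AR(1) rows\<close>

locale ar1_rows = prob_space M for M :: "'a measure" +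
  fixes n :: nat and \<phi> \<sigma> :: real and Z E :: "nat \<Rightarrow> int \<Rightarrow> 'a \<Rightarrow> real"
  assumes phi: "\<bar>\<phi>\<bar> < 1" and sigma: "\<sigma> > 0"
    and Z_normal: "\<And>i t. i \<in> {1..n} \<Longrightarrow> distributed M lborel (Z i t) (normal_density 0 \<sigma>)"
    and Z_indep: "indep_vars (\<lambda>_. borel) (\<lambda>(i, t). Z i t) ({1..n} \<times> UNIV)"
    and ar1: "\<And>i. i \<in> {1..n} \<Longrightarrow> stationary_ar1 M \<phi> (Z i) (E i)"
begin

section \<open>Independence of past and later innovations\<close>

definition past :: "int \<Rightarrow> (nat \<times> int) set" where
  "past t = {1..n} \<times> {..t}"

text \<open>\<open>restrict\<close> makes the family an element of the product space over
  \<open>K\<close>, the form in which independence of blocks is available.\<close>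

definition innovations :: "(nat \<times> int) set \<Rightarrow> 'a \<Rightarrow> nat \<times> int \<Rightarrow> real" where
  "innovations K \<omega> = restrict (\<lambda>k. (case k of (i, t) \<Rightarrow> Z i t) \<omega>) K"

text \<open>Equality with a function of the past is only required almost surely, because the series for
  \<open>E i t\<close> converges only almost surely.\<close>

definition adapted :: "int \<Rightarrow> ('a \<Rightarrow> real) \<Rightarrow> bool" where
  "adapted t U \<longleftrightarrow> U \<in> borel_measurable M \<and> (\<exists>f \<in> borel_measurable (PiM (past t) (\<lambda>_. borel)).
     AE \<omega> in M. U \<omega> = f (innovations (past t) \<omega>))"

lemma Z_measurable [measurable]: "i \<in> {1..n} \<Longrightarrow> Z i t \<in> borel_measurable M"
  using Z_normal[of i t] by (simp add: distributed_def)

lemma E_measurable: "i \<in> {1..n} \<Longrightarrow> E i t \<in> borel_measurable M"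
  using ar1[of i] by (simp add: stationary_ar1_def)

lemma E_rec: "i \<in> {1..n} \<Longrightarrow> AE \<omega> in M. E i t \<omega> = \<phi> * E i (t - 1) \<omega> + Z i t \<omega>"
proof -
  assume "i \<in> {1..n}"
  then have "AE \<omega> in M. E i t \<omega> - \<phi> * E i (t - 1) \<omega> = Z i t \<omega>"
    using ar1[of i] by (simp add: stationary_ar1_def)
  then show ?thesis by eventually_elim simp
qed

lemma adapted_mono: "adapted s U \<Longrightarrow> s \<le> t \<Longrightarrow> adapted t U"
proof -
  assume U: "adapted s U" and st: "s \<le> t"
  have sub: "past s \<subseteq> past t" using st by (auto simp: past_def)
  obtain f where [measurable]: "f \<in> borel_measurable (PiM (past s) (\<lambda>_. borel))"
    and f: "AE \<omega> in M. U \<omega> = f (innovations (past s) \<omega>)"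
    using U by (auto simp: adapted_def)
  have "(\<lambda>x. f (restrict x (past s))) \<in> borel_measurable (PiM (past t) (\<lambda>_. borel))"
    using measurable_restrict_subset[OF sub, of "\<lambda>_. borel"] by measurable
  moreover have "innovations (past s) \<omega> = restrict (innovations (past t) \<omega>) (past s)" for \<omega>
    using sub by (auto simp: innovations_def restrict_def fun_eq_iff)
  ultimately show "adapted t U"
    using f U by (auto simp: adapted_def intro!: bexI[of _ "\<lambda>x. f (restrict x (past s))"])
qed

lemma adapted_mult:
  assumes "adapted t U" "adapted t V"
  shows "adapted t (\<lambda>\<omega>. U \<omega> * V \<omega>)"
proof -
  obtain f g where f: "f \<in> borel_measurable (PiM (past t) (\<lambda>_. borel))"
      "AE \<omega> in M. U \<omega> = f (innovations (past t) \<omega>)"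
    and g: "g \<in> borel_measurable (PiM (past t) (\<lambda>_. borel))"
      "AE \<omega> in M. V \<omega> = g (innovations (past t) \<omega>)"
    using assms by (auto simp: adapted_def)
  have "AE \<omega> in M. U \<omega> * V \<omega> = (\<lambda>x. f x * g x) (innovations (past t) \<omega>)"
    using f(2) g(2) by eventually_elim simp
  moreover have "(\<lambda>x. f x * g x) \<in> borel_measurable (PiM (past t) (\<lambda>_. borel))"
    using f(1) g(1) by measurable
  ultimately show ?thesis using assms unfolding adapted_def
    by (intro conjI bexI[of _ "\<lambda>x. f x * g x"]) auto
qed

lemma adapted_Z: "i \<in> {1..n} \<Longrightarrow> adapted t (Z i t)"
  unfolding adapted_def
  by (auto simp: innovations_def past_def intro!: bexI[of _ "\<lambda>x. x (i, t)"])

lemma adapted_E: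
  assumes i: "i \<in> {1..n}"
  shows "adapted t (E i t)"
proof -
  have "AE \<omega> in M. (\<lambda>j. \<phi> ^ j * Z i (t - int j) \<omega>) sums E i t \<omega>"
    using ar1[OF i] by (simp add: stationary_ar1_def)
  then have "AE \<omega> in M. E i t \<omega> = (\<lambda>x. \<Sum>j. \<phi> ^ j * x (i, t - int j)) (innovations (past t) \<omega>)"
    by eventually_elim (use i in \<open>auto simp: sums_iff innovations_def past_def\<close>)
  moreover have "(\<lambda>x. \<Sum>j. \<phi> ^ j * x (i, t - int j)) \<in> borel_measurable (PiM (past t) (\<lambda>_. borel))"
  proof -
    have "(\<lambda>x. \<phi> ^ j * x (i, t - int j)) \<in> borel_measurable (PiM (past t) (\<lambda>_. borel))" for j
      by (intro borel_measurable_times borel_measurable_const measurable_component_singleton)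
        (use i in \<open>auto simp: past_def\<close>)
    then show ?thesis by (rule borel_measurable_suminf)
  qed
  ultimately show ?thesis using E_measurable[OF i] by (auto simp: adapted_def)
qed

text \<open>The innovations up to time \<open>t\<close> and those indexed by \<open>B\<close> are
  disjoint blocks of an independent family. \<open>U\<close> is a function of the first block only
  almost surely, so integrability and expectation are transferred along that equality.\<close>

lemma
  assumes U: "adapted t U" "integrable M U"
    and B: "B \<subseteq> {1..n} \<times> {t<..}" and g: "g \<in> borel_measurable (PiM B (\<lambda>_. borel))"
    and V: "integrable M (\<lambda>\<omega>. g (innovations B \<omega>))"
  shows adapted_mult_integrable: "integrable M (\<lambda>\<omega>. U \<omega> * g (innovations B \<omega>))"
    and expectation_adapted_mult: "expectation (\<lambda>\<omega>. U \<omega> * g (innovations B \<omega>)) =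
      expectation U * expectation (\<lambda>\<omega>. g (innovations B \<omega>))"
proof -
  obtain f where f: "f \<in> borel_measurable (PiM (past t) (\<lambda>_. borel))"
      and fU: "AE \<omega> in M. U \<omega> = f (innovations (past t) \<omega>)"
    using U(1) by (auto simp: adapted_def)
  \<comment> \<open>Indexing the two blocks by a Boolean turns the grouping theorem for independent
    families into independence of a pair.\<close>
  let ?K = "case_bool (past t) B"
  have "indep_vars (\<lambda>j. PiM (?K j) (\<lambda>_. borel)) (\<lambda>j \<omega>. restrict (\<lambda>i. (case i of (i, t) \<Rightarrow> Z i t) \<omega>) (?K j)) UNIV"
    by (rule indep_vars_restrict[OF Z_indep])
      (use B in \<open>auto simp: past_def disjoint_family_on_def split: bool.split\<close>)
  also have "(\<lambda>j. PiM (?K j) (\<lambda>_. borel)) = case_bool (PiM (past t) (\<lambda>_. borel)) (PiM B (\<lambda>_. borel))"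
    by (rule ext) (simp split: bool.split)
  also have "(\<lambda>j \<omega>. restrict (\<lambda>i. (case i of (i, t) \<Rightarrow> Z i t) \<omega>) (?K j)) =
      case_bool (innovations (past t)) (innovations B)"
    by (intro ext) (simp add: innovations_def split: bool.split)
  finally have "indep_var (PiM (past t) (\<lambda>_. borel)) (innovations (past t)) (PiM B (\<lambda>_. borel)) (innovations B)"
    by (simp add: indep_var_def)
  from indep_var_compose[OF this f g]
  have ind: "indep_var borel (\<lambda>\<omega>. f (innovations (past t) \<omega>)) borel (\<lambda>\<omega>. g (innovations B \<omega>))"
    by (simp add: comp_def)
  have fm: "(\<lambda>\<omega>. f (innovations (past t) \<omega>)) \<in> borel_measurable M"
    using indep_var_rv1[OF ind] by simp
  have fi: "integrable M (\<lambda>\<omega>. f (innovations (past t) \<omega>))"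
    using integrable_cong_AE[OF borel_measurable_integrable[OF U(2)] fm fU] U(2) by simp
  have fe: "expectation (\<lambda>\<omega>. f (innovations (past t) \<omega>)) = expectation U"
    by (rule integral_cong_AE[OF borel_measurable_integrable[OF U(2)] fm fU, symmetric])
  have eq: "AE \<omega> in M. f (innovations (past t) \<omega>) * g (innovations B \<omega>) = U \<omega> * g (innovations B \<omega>)"
    using fU by eventually_elim simp
  note m = borel_measurable_times[OF fm borel_measurable_integrable[OF V]]
    borel_measurable_times[OF borel_measurable_integrable[OF U(2)] borel_measurable_integrable[OF V]]
  show "integrable M (\<lambda>\<omega>. U \<omega> * g (innovations B \<omega>))"
    using indep_var_integrable[OF ind fi V] integrable_cong_AE[OF m eq] by simp
  show "expectation (\<lambda>\<omega>. U \<omega> * g (innovations B \<omega>)) =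
      expectation U * expectation (\<lambda>\<omega>. g (innovations B \<omega>))"
    using indep_var_lebesgue_integral[OF ind fi V] integral_cong_AE[OF m eq] fe by simp
qed

section \<open>Moments of the innovations\<close>

lemma Z_moment_integrable: "i \<in> {1..n} \<Longrightarrow> integrable M (\<lambda>\<omega>. Z i t \<omega> ^ k)"
  using distributed_integrable[OF Z_normal, of i "\<lambda>x. x ^ k" t]
    integrable_normal_moment[OF sigma, of 0 k] by simp

lemma expectation_Z: "i \<in> {1..n} \<Longrightarrow> expectation (Z i t) = 0"
  by (rule normal_distributed_expectation[OF sigma Z_normal])

lemma Z_integrable: "i \<in> {1..n} \<Longrightarrow> integrable M (Z i t)"
  using Z_moment_integrable[of i t 1] by simp

lemma expectation_Z_even_power:
  "i \<in> {1..n} \<Longrightarrow> expectation (\<lambda>\<omega>. Z i t \<omega> ^ (2 * k)) = fact (2 * k) / ((2 / \<sigma>\<^sup>2) ^ k * fact k)"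
  using distributed_integral[OF Z_normal, of i "\<lambda>x. x ^ (2 * k)" t]
    integral_normal_moment_even[OF sigma, of 0 k] by simp

lemma expectation_Z_square: "i \<in> {1..n} \<Longrightarrow> expectation (\<lambda>\<omega>. (Z i t \<omega>)\<^sup>2) = \<sigma>\<^sup>2"
  using expectation_Z_even_power[of i t 1] by simp

lemma square_integrable_Z: "i \<in> {1..n} \<Longrightarrow> square_integrable M (Z i t)"
  using Z_moment_integrable[of i t 2] by (simp add: square_integrable_def)

text \<open>\<open>g\<close> is the identity for the covariances of the innovations, and
  \<open>x\<^sup>2 - \<sigma>\<^sup>2\<close> for the orthogonality of their centred
  squares.\<close>

lemma expectation_Z_pair:
  assumes "i \<in> {1..n}" "j \<in> {1..n}" "(i, s) \<noteq> (j, t)"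
    and g: "g \<in> borel_measurable borel" "\<And>i t. i \<in> {1..n} \<Longrightarrow> integrable M (\<lambda>\<omega>. g (Z i t \<omega>) :: real)"
  shows "expectation (\<lambda>\<omega>. g (Z i s \<omega>) * g (Z j t \<omega>)) =
    expectation (\<lambda>\<omega>. g (Z i s \<omega>)) * expectation (\<lambda>\<omega>. g (Z j t \<omega>))"
proof -
  let ?X = "\<lambda>k \<omega>. g ((case k of (i, t) \<Rightarrow> Z i t) \<omega>)"
  have "indep_vars (\<lambda>_. borel) ?X ({1..n} \<times> UNIV)"
    by (rule indep_vars_compose2[OF Z_indep]) (use g in simp)
  then have "indep_vars (\<lambda>_. borel) ?X {(i, s), (j, t)}"
    by (rule indep_vars_subset) (use assms in auto)
  from indep_vars_lebesgue_integral[OF _ this] show ?thesis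
    using assms by (auto split: prod.splits)
qed

lemma expectation_Z_mult:
  assumes "i \<in> {1..n}" "j \<in> {1..n}"
  shows "expectation (\<lambda>\<omega>. Z i s \<omega> * Z j t \<omega>) = (if (i, s) = (j, t) then \<sigma>\<^sup>2 else 0)"
  using expectation_Z_pair[OF assms, of s t "\<lambda>x. x"] expectation_Z_square[of i s] assms
  by (auto simp: Z_integrable expectation_Z power2_eq_square)

text \<open>The martingale difference property: a later innovation is independent of
  \<open>U\<close> and has mean zero.\<close>

lemma
  assumes "adapted s U" "integrable M U" "s < t" "j \<in> {1..n}"
  shows adapted_mult_Z_integrable: "integrable M (\<lambda>\<omega>. U \<omega> * Z j t \<omega>)"
    and expectation_adapted_mult_Z: "expectation (\<lambda>\<omega>. U \<omega> * Z j t \<omega>) = 0"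
proof -
  have B: "{(j, t)} \<subseteq> {1..n} \<times> {s<..}" using assms by auto
  have g: "(\<lambda>x. x (j, t)) \<in> borel_measurable (PiM {(j, t)} (\<lambda>_. borel))"
    by (rule measurable_component_singleton) simp
  have *: "innovations {(j, t)} \<omega> (j, t) = Z j t \<omega>" for \<omega> by (simp add: innovations_def)
  have "integrable M (\<lambda>\<omega>. innovations {(j, t)} \<omega> (j, t))"
    unfolding * using Z_integrable[OF assms(4)] by simp
  from adapted_mult_integrable[OF assms(1,2) B g this] expectation_adapted_mult[OF assms(1,2) B g this]
  show "integrable M (\<lambda>\<omega>. U \<omega> * Z j t \<omega>)" "expectation (\<lambda>\<omega>. U \<omega> * Z j t \<omega>) = 0"
    using expectation_Z[OF assms(4)] by (simp_all add: *)
qed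

text \<open>The two innovations belong to the same later time. The case \<open>j = k\<close> gives
  the size of the products of errors and innovations, the other case their orthogonality at equal
  times.\<close>

lemma
  assumes "adapted s U" "integrable M U" "s < t" "j \<in> {1..n}" "k \<in> {1..n}"
  shows adapted_mult_ZZ_integrable: "integrable M (\<lambda>\<omega>. U \<omega> * (Z j t \<omega> * Z k t \<omega>))"
    and expectation_adapted_mult_ZZ:
      "expectation (\<lambda>\<omega>. U \<omega> * (Z j t \<omega> * Z k t \<omega>)) = expectation U * (if j = k then \<sigma>\<^sup>2 else 0)"
proof -
  let ?B = "{(j, t), (k, t)}"
  have B: "?B \<subseteq> {1..n} \<times> {s<..}" using assms by auto
  have g: "(\<lambda>x. x (j, t) * x (k, t) :: real) \<in> borel_measurable (PiM ?B (\<lambda>_. borel))"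
    by (intro borel_measurable_times measurable_component_singleton) auto
  have *: "innovations ?B \<omega> (j, t) = Z j t \<omega>" "innovations ?B \<omega> (k, t) = Z k t \<omega>" for \<omega>
    by (simp_all add: innovations_def)
  have "integrable M (\<lambda>\<omega>. innovations ?B \<omega> (j, t) * innovations ?B \<omega> (k, t))"
    unfolding * using assms by (intro square_integrable_mult_integrable square_integrable_Z)
  from adapted_mult_integrable[OF assms(1,2) B g this] expectation_adapted_mult[OF assms(1,2) B g this]
  show "integrable M (\<lambda>\<omega>. U \<omega> * (Z j t \<omega> * Z k t \<omega>))"
    "expectation (\<lambda>\<omega>. U \<omega> * (Z j t \<omega> * Z k t \<omega>)) = expectation U * (if j = k then \<sigma>\<^sup>2 else 0)"
    using expectation_Z_mult[OF assms(4,5)] by (simp_all add: *)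
qed

section \<open>Moments and autocovariances of the stationary process\<close>

lemma phi_square_less_1: "\<phi>\<^sup>2 < 1"
  using phi by (simp add: abs_square_less_1)

text \<open>The series converges almost surely, so the bound is carried from its partial sums to the
  limit by Fatou's lemma. It is uniform in \<open>t\<close>, which is what the uniqueness of bounded
  solutions of the moment recursions asks for; the exact value comes from there.\<close>

lemma square_integrable_E_bound:
  assumes i: "i \<in> {1..n}"
  shows "square_integrable M (E i t) \<and> expectation (\<lambda>\<omega>. (E i t \<omega>)\<^sup>2) \<le> \<sigma>\<^sup>2 / (1 - \<phi>\<^sup>2)"
proof -
  define S where "S k \<omega> = (\<Sum>j<k. \<phi> ^ j * Z i (t - int j) \<omega>)" for k \<omega>
  let ?\<gamma> = "\<sigma>\<^sup>2 / (1 - \<phi>\<^sup>2)"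
  have S: "square_integrable M (S k)" for k
    unfolding S_def using i
    by (intro square_integrable_sum square_integrable_cmult square_integrable_Z) auto
  have ES: "expectation (\<lambda>\<omega>. (S k \<omega>)\<^sup>2) \<le> ?\<gamma>" for k
  proof -
    have "expectation (\<lambda>\<omega>. (S k \<omega>)\<^sup>2) =
        (\<Sum>j<k. expectation (\<lambda>\<omega>. (\<phi> ^ j * Z i (t - int j) \<omega>)\<^sup>2))"
      unfolding S_def
    proof (rule integral_square_sum_orthogonal)
      fix j l assume "j \<in> {..<k}" "l \<in> {..<k}" "j \<noteq> l"
      have "expectation (\<lambda>\<omega>. \<phi> ^ j * \<phi> ^ l * (Z i (t - int j) \<omega> * Z i (t - int l) \<omega>)) = 0"
        using expectation_Z_mult[OF i i, of "t - int j" "t - int l"] \<open>j \<noteq> l\<close> by simp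
      then show "expectation (\<lambda>\<omega>. \<phi> ^ j * Z i (t - int j) \<omega> * (\<phi> ^ l * Z i (t - int l) \<omega>)) = 0"
        by (simp add: mult_ac)
    qed (use i in \<open>auto intro!: square_integrable_cmult square_integrable_Z\<close>)
    also have "\<dots> = (\<Sum>j<k. (\<phi>\<^sup>2) ^ j) * \<sigma>\<^sup>2"
      using expectation_Z_square[OF i]
      by (simp add: power_mult_distrib sum_distrib_left power_mult[symmetric] mult.commute)
    also have "\<dots> \<le> (\<Sum>j. (\<phi>\<^sup>2) ^ j) * \<sigma>\<^sup>2"
      using phi_square_less_1 by (intro mult_right_mono sum_le_suminf summable_geometric) auto
    also have "\<dots> = ?\<gamma>" using phi_square_less_1 by (subst suminf_geometric) auto
    finally show ?thesis .
  qed
  have Em: "E i t \<in> borel_measurable M" by (rule E_measurable[OF i])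
  have "AE \<omega> in M. (\<lambda>j. \<phi> ^ j * Z i (t - int j) \<omega>) sums E i t \<omega>"
    using ar1[OF i] by (simp add: stationary_ar1_def)
  then have "AE \<omega> in M. ennreal ((E i t \<omega>)\<^sup>2) = liminf (\<lambda>k. ennreal ((S k \<omega>)\<^sup>2))"
  proof eventually_elim
    case (elim \<omega>)
    then have "(\<lambda>k. S k \<omega>) \<longlonglongrightarrow> E i t \<omega>" by (simp add: sums_def S_def)
    then have "(\<lambda>k. ennreal ((S k \<omega>)\<^sup>2)) \<longlonglongrightarrow> ennreal ((E i t \<omega>)\<^sup>2)"
      by (intro tendsto_ennrealI tendsto_power)
    then show ?case by (intro lim_imp_Liminf[symmetric]) auto
  qed
  then have "(\<integral>\<^sup>+\<omega>. ennreal ((E i t \<omega>)\<^sup>2) \<partial>M) = (\<integral>\<^sup>+\<omega>. liminf (\<lambda>k. ennreal ((S k \<omega>)\<^sup>2)) \<partial>M)"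
    by (rule nn_integral_cong_AE)
  also have "\<dots> \<le> liminf (\<lambda>k. \<integral>\<^sup>+\<omega>. ennreal ((S k \<omega>)\<^sup>2) \<partial>M)"
    using S by (intro nn_integral_liminf) (auto simp: square_integrable_def)
  also have "\<dots> \<le> ennreal ?\<gamma>"
  proof (rule Liminf_le)
    have "(\<integral>\<^sup>+\<omega>. ennreal ((S k \<omega>)\<^sup>2) \<partial>M) \<le> ennreal ?\<gamma>" for k
      using S[of k] ES[of k] by (subst nn_integral_eq_integral) (auto simp: square_integrable_def ennreal_leI)
    then show "\<forall>\<^sub>F k in sequentially. (\<integral>\<^sup>+\<omega>. ennreal ((S k \<omega>)\<^sup>2) \<partial>M) \<le> ennreal ?\<gamma>" by simp
  qed simp
  finally have le: "(\<integral>\<^sup>+\<omega>. ennreal ((E i t \<omega>)\<^sup>2) \<partial>M) \<le> ennreal ?\<gamma>" .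
  then have int: "integrable M (\<lambda>\<omega>. (E i t \<omega>)\<^sup>2)"
    using Em by (intro integrableI_bounded) (auto simp: le_less_trans)
  have "ennreal (expectation (\<lambda>\<omega>. (E i t \<omega>)\<^sup>2)) \<le> ennreal ?\<gamma>"
    using le nn_integral_eq_integral[OF int] by simp
  moreover have "0 \<le> ?\<gamma>" using phi_square_less_1 by simp
  ultimately show ?thesis using int Em by (simp add: square_integrable_def)
qed

lemmas square_integrable_E = square_integrable_E_bound[THEN conjunct1]

lemma E_integrable: "i \<in> {1..n} \<Longrightarrow> integrable M (E i t)"
  by (rule square_integrable_imp_integrable[OF square_integrable_E])

lemma expectation_E:
  assumes i: "i \<in> {1..n}"
  shows "expectation (E i t) = 0"
proof -
  note int = E_integrable[OF i]
  have "expectation (E i t) = 0 / (1 - \<phi>)"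
  proof (rule bounded_solution_of_affine_recursion[OF phi])
    fix t
    have "expectation (E i t) = expectation (\<lambda>\<omega>. \<phi> * E i (t - 1) \<omega> + Z i t \<omega>)"
      using E_rec[OF i] i E_measurable[OF i] by (intro integral_cong_AE) auto
    then show "expectation (E i t) = \<phi> * expectation (E i (t - 1)) + 0"
      using int Z_integrable[OF i] expectation_Z[OF i] by simp
    have "\<bar>expectation (E i t)\<bar> \<le> expectation (\<lambda>\<omega>. \<bar>E i t \<omega>\<bar>)" by (rule integral_abs_bound)
    also have "\<dots> \<le> expectation (\<lambda>\<omega>. 1 + (E i t \<omega>)\<^sup>2)"
    proof (rule integral_mono)
      show "\<bar>E i t \<omega>\<bar> \<le> 1 + (E i t \<omega>)\<^sup>2" for \<omega>
        using zero_le_power2[of "\<bar>E i t \<omega>\<bar> - 1"] zero_le_power2[of "E i t \<omega>"]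
        unfolding power2_diff by simp
    qed (use square_integrable_E[OF i] int in \<open>auto simp: square_integrable_def\<close>)
    also have "\<dots> \<le> 1 + \<sigma>\<^sup>2 / (1 - \<phi>\<^sup>2)"
      using square_integrable_E_bound[OF i] by (simp add: square_integrable_def prob_space)
    finally show "\<bar>expectation (E i t)\<bar> \<le> 1 + \<sigma>\<^sup>2 / (1 - \<phi>\<^sup>2)" .
  qed
  then show ?thesis by simp
qed

lemma E_pair_integrable:
  "i \<in> {1..n} \<Longrightarrow> j \<in> {1..n} \<Longrightarrow> integrable M (\<lambda>\<omega>. E i s \<omega> * E j t \<omega>)"
  by (intro square_integrable_mult_integrable square_integrable_E)

text \<open>Multiplying the recursions of rows \<open>i\<close> and \<open>j\<close> gives an affine
  recursion with factor \<open>\<phi>\<^sup>2\<close>, because the mixed terms pair an innovation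
  with an earlier error. Its only bounded solution is the claimed value.\<close>

lemma expectation_E_mult:
  assumes i: "i \<in> {1..n}" and j: "j \<in> {1..n}"
  shows "expectation (\<lambda>\<omega>. E i t \<omega> * E j t \<omega>) = (if i = j then \<sigma>\<^sup>2 / (1 - \<phi>\<^sup>2) else 0)"
proof -
  have EZ: "integrable M (\<lambda>\<omega>. E i (t - 1) \<omega> * Z j t \<omega>)" "expectation (\<lambda>\<omega>. E i (t - 1) \<omega> * Z j t \<omega>) = 0"
    if "i \<in> {1..n}" "j \<in> {1..n}" for i j t
    using adapted_mult_Z_integrable[OF adapted_E[OF that(1)] E_integrable[OF that(1)] _ that(2), of "t - 1" t]
      expectation_adapted_mult_Z[OF adapted_E[OF that(1)] E_integrable[OF that(1)] _ that(2), of "t - 1" t]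
    by simp_all
  have ZZ: "integrable M (\<lambda>\<omega>. Z i t \<omega> * Z j t \<omega>)" for t
    using i j by (intro square_integrable_mult_integrable square_integrable_Z)
  have "expectation (\<lambda>\<omega>. E i t \<omega> * E j t \<omega>) = (if i = j then \<sigma>\<^sup>2 else 0) / (1 - \<phi>\<^sup>2)"
  proof (rule bounded_solution_of_affine_recursion)
    show "\<bar>\<phi>\<^sup>2\<bar> < 1" using phi_square_less_1 by simp
    fix t
    have "AE \<omega> in M. E i t \<omega> * E j t \<omega> = \<phi>\<^sup>2 * (E i (t - 1) \<omega> * E j (t - 1) \<omega>)
        + \<phi> * (E i (t - 1) \<omega> * Z j t \<omega>) + \<phi> * (E j (t - 1) \<omega> * Z i t \<omega>) + Z i t \<omega> * Z j t \<omega>"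
      using E_rec[OF i, of t] E_rec[OF j, of t]
      by eventually_elim (simp add: power2_eq_square algebra_simps)
    then have "expectation (\<lambda>\<omega>. E i t \<omega> * E j t \<omega>) =
      expectation (\<lambda>\<omega>. \<phi>\<^sup>2 * (E i (t - 1) \<omega> * E j (t - 1) \<omega>)
        + \<phi> * (E i (t - 1) \<omega> * Z j t \<omega>) + \<phi> * (E j (t - 1) \<omega> * Z i t \<omega>) + Z i t \<omega> * Z j t \<omega>)"
      using i j E_measurable by (intro integral_cong_AE) auto
    also have "\<dots> = \<phi>\<^sup>2 * expectation (\<lambda>\<omega>. E i (t - 1) \<omega> * E j (t - 1) \<omega>) + expectation (\<lambda>\<omega>. Z i t \<omega> * Z j t \<omega>)"
      using EZ[OF i j] EZ[OF j i] ZZ E_pair_integrable[OF i j] by simp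
    finally show "expectation (\<lambda>\<omega>. E i t \<omega> * E j t \<omega>) =
      \<phi>\<^sup>2 * expectation (\<lambda>\<omega>. E i (t - 1) \<omega> * E j (t - 1) \<omega>) + (if i = j then \<sigma>\<^sup>2 else 0)"
      using expectation_Z_mult[OF i j, of t t] by simp
    have "\<bar>expectation (\<lambda>\<omega>. E i t \<omega> * E j t \<omega>)\<bar> \<le> expectation (\<lambda>\<omega>. \<bar>E i t \<omega> * E j t \<omega>\<bar>)"
      by (rule integral_abs_bound)
    also have "\<dots> \<le> expectation (\<lambda>\<omega>. (E i t \<omega>)\<^sup>2 + (E j t \<omega>)\<^sup>2)"
    proof (rule integral_mono)
      show "\<bar>E i t \<omega> * E j t \<omega>\<bar> \<le> (E i t \<omega>)\<^sup>2 + (E j t \<omega>)\<^sup>2" for \<omega>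
        using sum_squares_bound[of "\<bar>E i t \<omega>\<bar>" "\<bar>E j t \<omega>\<bar>"] 
          mult_nonneg_nonneg[of "\<bar>E i t \<omega>\<bar>" "\<bar>E j t \<omega>\<bar>"]
        by (simp add: abs_mult del: zero_le_mult_iff mult_nonneg_nonneg)
    qed (use square_integrable_E E_pair_integrable i j in \<open>auto simp: square_integrable_def\<close>)
    also have "\<dots> \<le> \<sigma>\<^sup>2 / (1 - \<phi>\<^sup>2) + \<sigma>\<^sup>2 / (1 - \<phi>\<^sup>2)"
      using square_integrable_E_bound[OF i, of t] square_integrable_E_bound[OF j, of t]
      by (subst Bochner_Integration.integral_add) (auto simp: square_integrable_def intro: add_mono)
    finally show "\<bar>expectation (\<lambda>\<omega>. E i t \<omega> * E j t \<omega>)\<bar> \<le> \<sigma>\<^sup>2 / (1 - \<phi>\<^sup>2) + \<sigma>\<^sup>2 / (1 - \<phi>\<^sup>2)" .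
  qed
  then show ?thesis by simp
qed

text \<open>Each further time step multiplies by \<open>\<phi>\<close>, since the new innovation is
  orthogonal to the error at time \<open>t\<close>.\<close>

lemma expectation_E_lag:
  assumes i: "i \<in> {1..n}"
  shows "expectation (\<lambda>\<omega>. E i t \<omega> * E i (t + int k) \<omega>) = \<sigma>\<^sup>2 * (\<phi> ^ k / (1 - \<phi>\<^sup>2))"
proof (induction k)
  case 0
  then show ?case using expectation_E_mult[OF i i, of t] by simp
next
  case (Suc k)
  have EZ: "integrable M (\<lambda>\<omega>. E i t \<omega> * Z i (t + int (Suc k)) \<omega>)"
    "expectation (\<lambda>\<omega>. E i t \<omega> * Z i (t + int (Suc k)) \<omega>) = 0"
    using adapted_mult_Z_integrable[OF adapted_E[OF i] E_integrable[OF i] _ i, of t "t + int (Suc k)"]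
      expectation_adapted_mult_Z[OF adapted_E[OF i] E_integrable[OF i] _ i, of t "t + int (Suc k)"]
    by simp_all
  have "AE \<omega> in M. E i t \<omega> * E i (t + int (Suc k)) \<omega> =
      \<phi> * (E i t \<omega> * E i (t + int k) \<omega>) + E i t \<omega> * Z i (t + int (Suc k)) \<omega>"
    using E_rec[OF i, of "t + int (Suc k)"]
    by eventually_elim (simp add: algebra_simps)
  then have "expectation (\<lambda>\<omega>. E i t \<omega> * E i (t + int (Suc k)) \<omega>) =
     expectation (\<lambda>\<omega>. \<phi> * (E i t \<omega> * E i (t + int k) \<omega>) + E i t \<omega> * Z i (t + int (Suc k)) \<omega>)"
    using i E_measurable by (intro integral_cong_AE) auto
  also have "\<dots> = \<phi> * expectation (\<lambda>\<omega>. E i t \<omega> * E i (t + int k) \<omega>)"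
    using EZ E_pair_integrable[OF i i] by simp
  finally show ?case using Suc by simp
qed

lemma cov_mat_E:
  assumes i: "i \<in> {1..n}"
  shows "cov_mat M d (E i) = mat d d (\<lambda>(k, l). \<sigma>\<^sup>2 * (\<phi> ^ nat \<bar>int k - int l\<bar> / (1 - \<phi>\<^sup>2)))"
proof (rule eq_matI, goal_cases)
  case (1 k l)
  have *: "expectation (\<lambda>\<omega>. E i (int k + 1) \<omega> * E i (int l + 1) \<omega>) = \<sigma>\<^sup>2 * (\<phi> ^ nat \<bar>int k - int l\<bar> / (1 - \<phi>\<^sup>2))"
    if "k \<le> l" for k l :: nat
    using expectation_E_lag[OF i, of "int k + 1" "l - k"] that
    by (simp add: nat_diff_distrib' abs_minus_commute[of "int k"] add.commute)
  show ?case
    using 1 *[of k l] *[of l k] expectation_E[OF i]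
    by (cases "k \<le> l") (auto simp: cov_mat_def covariance_def mult.commute abs_minus_commute)
qed (auto simp: cov_mat_def)

section \<open>Second moments of bilinear and quadratic forms\<close>

text \<open>In the forms below the weight \<open>A i j\<close> belongs to the rows \<open>i + 1\<close> and \<open>j + 1\<close> of the model.\<close>

definition cross_form :: "(nat \<Rightarrow> nat \<Rightarrow> real) \<Rightarrow> int set \<Rightarrow> 'a \<Rightarrow> real" where
  "cross_form A T \<omega> =
     (\<Sum>t\<in>T. \<Sum>i<n. \<Sum>j<n. A i j * (E (Suc i) (t - 1) \<omega> * Z (Suc j) t \<omega>))"

definition Z_energy :: "(nat \<Rightarrow> nat \<Rightarrow> real) \<Rightarrow> int set \<Rightarrow> 'a \<Rightarrow> real" where
  "Z_energy A T \<omega> = (\<Sum>t\<in>T. \<Sum>i<n. (\<Sum>j<n. A i j * Z (Suc j) t \<omega>)\<^sup>2)"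

definition centred_Z_energy :: "int set \<Rightarrow> 'a \<Rightarrow> real" where
  "centred_Z_energy T \<omega> = (\<Sum>t\<in>T. \<Sum>i<n. (Z (Suc i) t \<omega>)\<^sup>2 - \<sigma>\<^sup>2)"

text \<open>The innovation is independent of the previous error, so the expectation of the square
  factors and second moments suffice.\<close>

lemma EZ_product:
  assumes "i \<in> {1..n}" "j \<in> {1..n}"
  shows "square_integrable M (\<lambda>\<omega>. E i (t - 1) \<omega> * Z j t \<omega>)"
    and "expectation (\<lambda>\<omega>. (E i (t - 1) \<omega> * Z j t \<omega>)\<^sup>2) = \<sigma>\<^sup>2 * \<sigma>\<^sup>2 / (1 - \<phi>\<^sup>2)"
proof -
  note ad = adapted_mult[OF adapted_E[OF assms(1)] adapted_E[OF assms(1)]]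
  note int = E_pair_integrable[OF assms(1,1)]
  have eq: "(E i (t - 1) \<omega> * Z j t \<omega>)\<^sup>2 = E i (t - 1) \<omega> * E i (t - 1) \<omega> * (Z j t \<omega> * Z j t \<omega>)" for \<omega>
    by (simp add: power2_eq_square)
  show "square_integrable M (\<lambda>\<omega>. E i (t - 1) \<omega> * Z j t \<omega>)"
    unfolding square_integrable_def eq
    using adapted_mult_ZZ_integrable[OF ad int _ assms(2,2), of "t - 1" t] E_measurable Z_measurable assms
    by simp
  show "expectation (\<lambda>\<omega>. (E i (t - 1) \<omega> * Z j t \<omega>)\<^sup>2) = \<sigma>\<^sup>2 * \<sigma>\<^sup>2 / (1 - \<phi>\<^sup>2)"
    unfolding eq using expectation_adapted_mult_ZZ[OF ad int _ assms(2,2), of "t - 1" t]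
      expectation_E_mult[OF assms(1,1)] by simp
qed

text \<open>The later of the two innovations is independent of the other three factors; for equal times the
  claim reduces to the uncorrelatedness of the rows.\<close>

lemma EZ_orthogonal:
  assumes "i \<in> {1..n}" "j \<in> {1..n}" "k \<in> {1..n}" "l \<in> {1..n}" and ne: "(t, i, j) \<noteq> (s, k, l)"
  shows "expectation (\<lambda>\<omega>. (E i (t - 1) \<omega> * Z j t \<omega>) * (E k (s - 1) \<omega> * Z l s \<omega>)) = 0"
proof -
  have later: "expectation (\<lambda>\<omega>. (E i (t - 1) \<omega> * Z j t \<omega>) * (E k (s - 1) \<omega> * Z l s \<omega>)) = 0"
    if "t < s" "i \<in> {1..n}" "j \<in> {1..n}" "k \<in> {1..n}" "l \<in> {1..n}" for t s i j k l
  proof -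
    have "adapted (s - 1) (\<lambda>\<omega>. (E i (t - 1) \<omega> * Z j t \<omega>) * E k (s - 1) \<omega>)"
      using that by (intro adapted_mult adapted_mono[OF adapted_E[of i]] adapted_mono[OF adapted_Z[of j]]
        adapted_E) auto
    moreover have "integrable M (\<lambda>\<omega>. (E i (t - 1) \<omega> * Z j t \<omega>) * E k (s - 1) \<omega>)"
      using that by (intro square_integrable_mult_integrable EZ_product square_integrable_E)
    ultimately have "expectation (\<lambda>\<omega>. (E i (t - 1) \<omega> * Z j t \<omega>) * E k (s - 1) \<omega> * Z l s \<omega>) = 0"
      using that by (intro expectation_adapted_mult_Z[of "s - 1"]) auto
    then show ?thesis by (simp add: mult.assoc)
  qed
  consider "t < s" | "s < t" | "s = t" by linarith
  then show ?thesis
  proof cases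
    case 1
    then show ?thesis using later assms by blast
  next
    case 2
    then show ?thesis using later[of s t k l i j] assms by (simp add: mult.commute)
  next
    case 3
    have "expectation (\<lambda>\<omega>. E i (t - 1) \<omega> * E k (t - 1) \<omega> * (Z j t \<omega> * Z l t \<omega>)) = 0"
      using assms 3 by (subst expectation_adapted_mult_ZZ[of "t - 1"])
        (auto simp: expectation_E_mult intro!: adapted_mult adapted_E E_pair_integrable)
    then show ?thesis using 3 by (simp add: mult_ac)
  qed
qed

text \<open>The summands are orthogonal with equal second moments up to the weights, so the squared
  Frobenius norm of \<open>A\<close> appears. For the residual projection it is at most
  \<open>n\<close>.\<close>

lemma cross_form_second_moment:
  assumes T: "finite T"
  shows "square_integrable M (cross_form A T)"
    and "expectation (\<lambda>\<omega>. (cross_form A T \<omega>)\<^sup>2) =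
      real (card T) * (\<sigma>\<^sup>2 * \<sigma>\<^sup>2 / (1 - \<phi>\<^sup>2)) * (\<Sum>i<n. \<Sum>j<n. (A i j)\<^sup>2)"
proof -
  define U where "U = (\<lambda>(t, i, j) \<omega>. A i j * (E (Suc i) (t - 1) \<omega> * Z (Suc j) t \<omega>))"
  let ?I = "T \<times> {..<n} \<times> {..<n}"
  have cross: "cross_form A T \<omega> = (\<Sum>x\<in>?I. U x \<omega>)" for \<omega>
    by (simp add: cross_form_def U_def sum.cartesian_product split_def)
  have sq: "square_integrable M (U x)" if "x \<in> ?I" for x
    using that by (auto simp: U_def intro!: square_integrable_cmult EZ_product)
  show "square_integrable M (cross_form A T)"
    unfolding cross[abs_def] using T sq by (intro square_integrable_sum) auto
  have "expectation (\<lambda>\<omega>. (cross_form A T \<omega>)\<^sup>2) = (\<Sum>x\<in>?I. expectation (\<lambda>\<omega>. (U x \<omega>)\<^sup>2))"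
    unfolding cross
  proof (rule integral_square_sum_orthogonal)
    fix x y assume x: "x \<in> ?I" and y: "y \<in> ?I" and ne: "x \<noteq> y"
    obtain t i j s k l where xy: "x = (t, i, j)" "y = (s, k, l)" by (cases x, cases y) auto
    have "expectation (\<lambda>\<omega>. A i j * A k l *
        ((E (Suc i) (t - 1) \<omega> * Z (Suc j) t \<omega>) * (E (Suc k) (s - 1) \<omega> * Z (Suc l) s \<omega>))) = 0"
      using EZ_orthogonal[of "Suc i" "Suc j" "Suc k" "Suc l" t s] x y ne xy by simp
    then show "expectation (\<lambda>\<omega>. U x \<omega> * U y \<omega>) = 0" by (simp add: U_def xy mult_ac)
  qed (use T sq in auto)
  also have "\<dots> = (\<Sum>(t, i, j)\<in>?I. (\<sigma>\<^sup>2 * \<sigma>\<^sup>2 / (1 - \<phi>\<^sup>2)) * (A i j)\<^sup>2)"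
    by (rule sum.cong) (auto simp: U_def power_mult_distrib[of "A _ _"] EZ_product)
  also have "\<dots> = (\<Sum>t\<in>T. \<Sum>i<n. \<Sum>j<n. (\<sigma>\<^sup>2 * \<sigma>\<^sup>2 / (1 - \<phi>\<^sup>2)) * (A i j)\<^sup>2)"
    by (simp add: sum.cartesian_product split_def del: sum_constant)
  also have "\<dots> = real (card T) * (\<sigma>\<^sup>2 * \<sigma>\<^sup>2 / (1 - \<phi>\<^sup>2)) * (\<Sum>i<n. \<Sum>j<n. (A i j)\<^sup>2)"
    by (simp add: sum_distrib_left mult.assoc)
  finally show "expectation (\<lambda>\<omega>. (cross_form A T \<omega>)\<^sup>2) =
    real (card T) * (\<sigma>\<^sup>2 * \<sigma>\<^sup>2 / (1 - \<phi>\<^sup>2)) * (\<Sum>i<n. \<Sum>j<n. (A i j)\<^sup>2)" .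
qed

lemma expectation_Z_combination_square:
  shows "square_integrable M (\<lambda>\<omega>. \<Sum>j<n. a j * Z (Suc j) t \<omega>)"
    and "expectation (\<lambda>\<omega>. (\<Sum>j<n. a j * Z (Suc j) t \<omega>)\<^sup>2) = \<sigma>\<^sup>2 * (\<Sum>j<n. (a j)\<^sup>2)"
proof -
  have sq: "square_integrable M (\<lambda>\<omega>. a j * Z (Suc j) t \<omega>)" if "j \<in> {..<n}" for j
    using that by (intro square_integrable_cmult square_integrable_Z) auto
  then show "square_integrable M (\<lambda>\<omega>. \<Sum>j<n. a j * Z (Suc j) t \<omega>)"
    by (intro square_integrable_sum) auto
  have "expectation (\<lambda>\<omega>. (\<Sum>j<n. a j * Z (Suc j) t \<omega>)\<^sup>2) =
      (\<Sum>j<n. expectation (\<lambda>\<omega>. (a j * Z (Suc j) t \<omega>)\<^sup>2))"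
  proof (rule integral_square_sum_orthogonal)
    fix i j assume "i \<in> {..<n}" "j \<in> {..<n}" "i \<noteq> j"
    then have "expectation (\<lambda>\<omega>. a i * a j * (Z (Suc i) t \<omega> * Z (Suc j) t \<omega>)) = 0"
      using expectation_Z_mult[of "Suc i" "Suc j" t t] by simp
    then show "expectation (\<lambda>\<omega>. a i * Z (Suc i) t \<omega> * (a j * Z (Suc j) t \<omega>)) = 0"
      by (simp add: mult_ac)
  qed (use sq in auto)
  also have "\<dots> = (\<Sum>j<n. \<sigma>\<^sup>2 * (a j)\<^sup>2)"
    by (rule sum.cong) (simp_all add: power_mult_distrib expectation_Z_square)
  finally show "expectation (\<lambda>\<omega>. (\<Sum>j<n. a j * Z (Suc j) t \<omega>)\<^sup>2) = \<sigma>\<^sup>2 * (\<Sum>j<n. (a j)\<^sup>2)"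
    by (simp add: sum_distrib_left)
qed

text \<open>With the entries of the hat matrix as weights the double sum is \<open>p\<close>:
  projecting onto the columns of \<open>X\<close> captures only a fraction \<open>p / n\<close> of
  the expected energy of the innovations.\<close>

lemma Z_energy_expectation:
  shows "integrable M (Z_energy A T)"
    and "expectation (Z_energy A T) = real (card T) * \<sigma>\<^sup>2 * (\<Sum>i<n. \<Sum>j<n. (A i j)\<^sup>2)"
proof -
  have int: "integrable M (\<lambda>\<omega>. (\<Sum>j<n. A i j * Z (Suc j) t \<omega>)\<^sup>2)" for i t
    using expectation_Z_combination_square(1) by (simp add: square_integrable_def)
  show "integrable M (Z_energy A T)"
    unfolding Z_energy_def[abs_def] by (intro Bochner_Integration.integrable_sum int)
  have "expectation (Z_energy A T) =
      (\<Sum>t\<in>T. \<Sum>i<n. expectation (\<lambda>\<omega>. (\<Sum>j<n. A i j * Z (Suc j) t \<omega>)\<^sup>2))"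
    unfolding Z_energy_def[abs_def] using int by simp
  then show "expectation (Z_energy A T) = real (card T) * \<sigma>\<^sup>2 * (\<Sum>i<n. \<Sum>j<n. (A i j)\<^sup>2)"
    by (simp add: expectation_Z_combination_square sum_distrib_left mult.assoc)
qed

text \<open>The centred squares are orthogonal, and the Gaussian fourth moment
  \<open>3 * \<sigma> ^ 4\<close> gives each of them the variance
  \<open>2 * \<sigma> ^ 4\<close>.\<close>

lemma centred_Z_energy_second_moment:
  assumes T: "finite T"
  shows "square_integrable M (centred_Z_energy T)"
    and "expectation (\<lambda>\<omega>. (centred_Z_energy T \<omega>)\<^sup>2) = real (card T) * real n * (2 * \<sigma> ^ 4)"
proof -
  let ?g = "\<lambda>x. x\<^sup>2 - \<sigma>\<^sup>2"
  let ?U = "\<lambda>(t, i) \<omega>. ?g (Z (Suc i) t \<omega>)"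
  let ?I = "T \<times> {..<n}"
  have eq: "centred_Z_energy T \<omega> = (\<Sum>x\<in>?I. ?U x \<omega>)" for \<omega>
    by (simp add: centred_Z_energy_def sum.cartesian_product split_def)
  have g2: "(?g x)\<^sup>2 = x ^ 4 - 2 * \<sigma>\<^sup>2 * x\<^sup>2 + \<sigma> ^ 4" for x
    by (simp add: power2_diff)
  have int: "integrable M (\<lambda>\<omega>. ?g (Z i t \<omega>))" "expectation (\<lambda>\<omega>. ?g (Z i t \<omega>)) = 0"
    and int2: "integrable M (\<lambda>\<omega>. (?g (Z i t \<omega>))\<^sup>2)"
    and exp2: "expectation (\<lambda>\<omega>. (?g (Z i t \<omega>))\<^sup>2) = 2 * \<sigma> ^ 4"
    if i: "i \<in> {1..n}" for i t
  proof -
    note m = Z_moment_integrable[OF i, of t 2] Z_moment_integrable[OF i, of t 4]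
    show "integrable M (\<lambda>\<omega>. ?g (Z i t \<omega>))" "expectation (\<lambda>\<omega>. ?g (Z i t \<omega>)) = 0"
      using m expectation_Z_square[OF i, of t] by (simp_all add: prob_space)
    show "integrable M (\<lambda>\<omega>. (?g (Z i t \<omega>))\<^sup>2)" unfolding g2 using m by simp
    have "expectation (\<lambda>\<omega>. Z i t \<omega> ^ 4) = 3 * \<sigma> ^ 4"
      using expectation_Z_even_power[OF i, of t 2]
      by (simp add: fact_numeral power_divide flip: power_mult)
    then show "expectation (\<lambda>\<omega>. (?g (Z i t \<omega>))\<^sup>2) = 2 * \<sigma> ^ 4"
      unfolding g2 using m expectation_Z_square[OF i, of t]
      by (simp add: prob_space)
  qed
  have sq: "square_integrable M (?U x)" if "x \<in> ?I" for x
    using that int int2 by (auto simp: square_integrable_def)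
  show "square_integrable M (centred_Z_energy T)"
    unfolding eq[abs_def] using T sq by (intro square_integrable_sum) auto
  have "expectation (\<lambda>\<omega>. (centred_Z_energy T \<omega>)\<^sup>2) = (\<Sum>x\<in>?I. expectation (\<lambda>\<omega>. (?U x \<omega>)\<^sup>2))"
    unfolding eq
  proof (rule integral_square_sum_orthogonal)
    fix x y assume x: "x \<in> ?I" and y: "y \<in> ?I" and ne: "x \<noteq> y"
    obtain t i s k where xy: "x = (t, i)" "y = (s, k)" by (cases x, cases y) auto
    have "expectation (\<lambda>\<omega>. ?g (Z (Suc i) t \<omega>) * ?g (Z (Suc k) s \<omega>)) = 0"
      using x y ne xy int by (subst expectation_Z_pair) auto
    then show "expectation (\<lambda>\<omega>. ?U x \<omega> * ?U y \<omega>) = 0" by (simp add: xy)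
  qed (use T sq in auto)
  also have "\<dots> = (\<Sum>x\<in>?I. 2 * \<sigma> ^ 4)"
    by (rule sum.cong) (auto simp: exp2)
  finally show "expectation (\<lambda>\<omega>. (centred_Z_energy T \<omega>)\<^sup>2) = real (card T) * real n * (2 * \<sigma> ^ 4)"
    by (simp add: card_cartesian_product)
qed

end

section \<open>The autoregression estimator\<close>

context ar1_rows
begin

text \<open>Column \<open>l\<close> of the error matrix holds the errors at time \<open>l + 1\<close>. So \<open>{1..<d}\<close> gives the times
  \<open>2, \<dots>, d\<close> of the numerator of \<^const>\<open>phi_hat\<close>, and \<open>{..<d - 1}\<close> the times \<open>1, \<dots>, d - 1\<close> of its
  denominator.\<close>

definition one_step_times :: "nat set \<Rightarrow> int set" where
  "one_step_times L = (\<lambda>l. int l + 1) ` L"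

lemma one_step_times [simp]: "finite L \<Longrightarrow> finite (one_step_times L)" "card (one_step_times L) = card L"
  by (auto simp: one_step_times_def card_image inj_on_def)

lemma sum_one_step_times: "(\<Sum>t\<in>one_step_times L. f t) = (\<Sum>l\<in>L. f (int l + 1))"
  by (simp add: one_step_times_def sum.reindex inj_on_def)

text \<open>The recursion holds only almost surely; the finitely many equations in use are collected
  into one event, on which the estimator is treated pointwise. Time 1 refers to the error at time 0,
  which belongs to the process but not to the error matrix.\<close>

definition follows_ar1 :: "nat \<Rightarrow> 'a \<Rightarrow> bool" where
  "follows_ar1 d \<omega> \<longleftrightarrow> (\<forall>i\<in>{1..n}. \<forall>t\<in>{1..int d}. E i t \<omega> = \<phi> * E i (t - 1) \<omega> + Z i t \<omega>)"

lemma AE_follows_ar1: "AE \<omega> in M. follows_ar1 d \<omega>"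
  unfolding follows_ar1_def using E_rec by (auto simp: AE_ball_countable intro!: AE_finite_allI)

context
  fixes X :: "real mat" and p d :: nat and R H :: "nat \<Rightarrow> nat \<Rightarrow> real"
  assumes X: "X \<in> carrier_mat n p" and inv: "invertible_mat (X\<^sup>T * X)" and d: "2 \<le> d"
  defines "H \<equiv> \<lambda>i j. hat_mat X $$ (i, j)" and "R \<equiv> \<lambda>i j. (if i = j then 1 else 0) - H i j"
begin

interpretation H: symmetric_idempotent n H
  unfolding H_def by (rule hat_mat_symmetric_idempotent[OF X inv])

interpretation R: symmetric_idempotent n R
  unfolding R_def by (rule H.complement)

lemma hat_entries_square_sum: "(\<Sum>i<n. \<Sum>j<n. (H i j)\<^sup>2) = real p"
  using H.sum_squares_entries hat_mat_trace[OF X inv] by (simp add: H_def)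

lemma residual_entries_square_sum: "(\<Sum>i<n. \<Sum>j<n. (R i j)\<^sup>2) \<le> real n"
proof -
  have "(\<Sum>i<n. \<Sum>j<n. (R i j)\<^sup>2) = (\<Sum>i<n. 1 - H i i)"
    unfolding R.sum_squares_entries by (simp add: R_def)
  also have "\<dots> = real n - real p"
    using hat_mat_trace[OF X inv] by (simp add: sum_subtractf H_def)
  finally show ?thesis by simp
qed

lemma residual_entry:
  assumes "i < n" "t < d"
  shows "(residual_proj X * error_mat n d E \<omega>) $$ (i, t) = (\<Sum>j<n. R i j * E (Suc j) (int t + 1) \<omega>)"
proof -
  have P: "residual_proj X \<in> carrier_mat n n"
    using X hat_mat_carrier[OF X inv] by (simp add: residual_proj_def hat_mat_def minus_carrier_mat)
  then show ?thesis
    using assms residual_proj_entry[OF X inv, of i]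
    by (simp add: error_mat_def scalar_prod_def lessThan_atLeast0 R_def H_def)
qed

text \<open>The deterministic core. \<open>m\<close> is the expected energy of the innovations over
  the times of the denominator. The three small terms cost at most \<open>m / 4\<close> each, so at
  least \<open>m / 4\<close> of the denominator remains, whence the factor 4.\<close>

lemma phi_hat_deviation:
  assumes rec: "follows_ar1 d \<omega>"
    and num: "\<bar>cross_form R (one_step_times {1..<d}) \<omega>\<bar> \<le> a"
    and cross: "\<bar>cross_form R (one_step_times {..<d - 1}) \<omega>\<bar> \<le> m / 8"
    and hat: "Z_energy H (one_step_times {..<d - 1}) \<omega> \<le> m / 4"
    and centred: "\<bar>centred_Z_energy (one_step_times {..<d - 1}) \<omega>\<bar> \<le> m / 4"
    and m: "m = real (d - 1) * real n * \<sigma>\<^sup>2" "0 < m"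
  shows "\<bar>phi_hat (residual_proj X * error_mat n d E \<omega>) - \<phi>\<bar> \<le> 4 * a / m"
proof -
  define r where "r i t = (\<Sum>j<n. R i j * E (Suc j) t \<omega>)" for i and t :: int
  define z where "z i t = (\<Sum>j<n. R i j * Z (Suc j) t \<omega>)" for i and t :: int
  have r_rec: "r i t = \<phi> * r i (t - 1) + z i t" if "t \<in> {1..int d}" for i t
  proof -
    have "r i t = (\<Sum>j<n. \<phi> * (R i j * E (Suc j) (t - 1) \<omega>) + R i j * Z (Suc j) t \<omega>)"
      unfolding r_def using rec that
      by (intro sum.cong refl) (simp add: follows_ar1_def distrib_left mult_ac)
    then show ?thesis by (simp add: r_def z_def sum.distrib sum_distrib_left)
  qed
  have rz: "(\<Sum>i<n. r i (t - 1) * z i t) = (\<Sum>i<n. \<Sum>j<n. R i j * (E (Suc i) (t - 1) \<omega> * Z (Suc j) t \<omega>))" for t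
    unfolding r_def z_def by (rule R.inner_product)
  have zz: "(\<Sum>i<n. (z i t)\<^sup>2) = (\<Sum>i<n. (Z (Suc i) t \<omega>)\<^sup>2) - (\<Sum>i<n. (\<Sum>j<n. H i j * Z (Suc j) t \<omega>)\<^sup>2)" for t
    unfolding z_def R_def by (rule H.complement_norm_square)
  define D where "D = (\<Sum>i<n. \<Sum>l<d - 1. (r i (int l + 1))\<^sup>2)"
  define N where "N = (\<Sum>i<n. \<Sum>l=1..<d. r i (int l + 1) * r i (int l))"
  let ?P = "residual_proj X * error_mat n d E \<omega>"
  have dims: "dim_row ?P = n" "dim_col ?P = d"
    using X by (simp_all add: residual_proj_def error_mat_def)
  have ratio: "phi_hat ?P = N / D"
  proof -
    have "(\<Sum>i<n. \<Sum>l=1..<d. ?P $$ (i, l) * ?P $$ (i, l - 1)) = N"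
      unfolding N_def r_def by (intro sum.cong refl) (auto simp: residual_entry of_nat_diff)
    moreover have "(\<Sum>i<n. \<Sum>l<d - 1. (?P $$ (i, l))\<^sup>2) = D"
      unfolding D_def r_def by (intro sum.cong refl) (simp add: residual_entry)
    ultimately show ?thesis unfolding phi_hat_def dims by simp
  qed
  \<comment> \<open>The same times 1 to \<open>d - 1\<close>, indexed so as to match the lagged
    factor in \<open>N\<close>.\<close>
  have D_shift: "D = (\<Sum>i<n. \<Sum>l=1..<d. (r i (int l))\<^sup>2)"
  proof -
    have "(\<Sum>l=1..<d. (r i (int l))\<^sup>2) = (\<Sum>l<d - 1. (r i (int l + 1))\<^sup>2)" for i
      using d sum.shift_bounds_Suc_ivl[of "\<lambda>l. (r i (int l))\<^sup>2" 0 "d - 1"]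
      by (simp add: lessThan_atLeast0 add.commute)
    then show ?thesis by (simp add: D_def)
  qed
  \<comment> \<open>Substituting the recursion for the leading factor in \<open>N\<close> cancels
    \<open>\<phi> * D\<close> and leaves products of a residual with the next projected
    innovation.\<close>
  have "N - \<phi> * D = (\<Sum>i<n. \<Sum>l=1..<d. r i (int l) * z i (int l + 1))"
    unfolding N_def D_shift sum_distrib_left sum_subtractf[symmetric]
    by (intro sum.cong refl) (simp add: r_rec power2_eq_square algebra_simps)
  also have "\<dots> = (\<Sum>l=1..<d. \<Sum>i<n. r i ((int l + 1) - 1) * z i (int l + 1))"
    by (subst sum.swap) simp
  also have "\<dots> = cross_form R (one_step_times {1..<d}) \<omega>"
    unfolding rz cross_form_def sum_one_step_times ..
  finally have ND: "N - \<phi> * D = cross_form R (one_step_times {1..<d}) \<omega>" .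
  \<comment> \<open>The left side is the squared length of the recursion without the square of
    \<open>\<phi> * r i (int l)\<close>; \<open>m\<close> undoes the centring, and Pythagoras
    accounts for the projected energy.\<close>
  have "2 * \<phi> * cross_form R (one_step_times {..<d - 1}) \<omega>
        + (centred_Z_energy (one_step_times {..<d - 1}) \<omega> + m - Z_energy H (one_step_times {..<d - 1}) \<omega>) =
      (\<Sum>l<d - 1. 2 * \<phi> * (\<Sum>i<n. r i ((int l + 1) - 1) * z i (int l + 1)) + (\<Sum>i<n. (z i (int l + 1))\<^sup>2))"
    unfolding rz zz cross_form_def centred_Z_energy_def Z_energy_def sum_one_step_times m
    by (simp add: sum.distrib sum_subtractf sum_distrib_left)
  also have "\<dots> = (\<Sum>l<d - 1. \<Sum>i<n. 2 * \<phi> * (r i (int l) * z i (int l + 1)) + (z i (int l + 1))\<^sup>2)"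
    by (simp add: sum.distrib sum_distrib_left)
  also have "\<dots> \<le> (\<Sum>l<d - 1. \<Sum>i<n. (r i (int l + 1))\<^sup>2)"
  proof (intro sum_mono)
    fix l i assume "l \<in> {..<d - 1}"
    then have eq: "r i (int l + 1) = \<phi> * r i (int l) + z i (int l + 1)" using r_rec[of "int l + 1" i] by simp
    show "2 * \<phi> * (r i (int l) * z i (int l + 1)) + (z i (int l + 1))\<^sup>2 \<le> (r i (int l + 1))\<^sup>2"
      unfolding eq power2_sum using zero_le_power2[of "\<phi> * r i (int l)"] by simp
  qed
  also have "\<dots> = D" unfolding D_def by (rule sum.swap)
  finally have D_ge: "2 * \<phi> * cross_form R (one_step_times {..<d - 1}) \<omega>
        + (centred_Z_energy (one_step_times {..<d - 1}) \<omega> + m - Z_energy H (one_step_times {..<d - 1}) \<omega>) \<le> D" .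
  have "\<bar>2 * \<phi> * cross_form R (one_step_times {..<d - 1}) \<omega>\<bar> \<le> 2 * 1 * (m / 8)"
    unfolding abs_mult using phi cross by (intro mult_mono) auto
  then have D4: "m / 4 \<le> D" using D_ge hat centred by linarith
  then have D0: "0 < D" using m(2) by linarith
  have "phi_hat ?P - \<phi> = (N - \<phi> * D) / D" unfolding ratio using D0 by (simp add: diff_divide_distrib)
  also have "\<bar>\<dots>\<bar> = \<bar>cross_form R (one_step_times {1..<d}) \<omega>\<bar> / D" unfolding ND using D0 by simp
  also have "\<dots> \<le> a / (m / 4)"
    using num D4 m(2) by (intro frac_le) auto
  finally show ?thesis by (simp add: mult.commute)
qed

text \<open>A bound for each fixed sample. The first failure term is made small by the choice of
  \<open>K\<close>, uniformly in \<open>n\<close> and \<open>d\<close>; the second, which comes from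
  the denominator, vanishes as \<open>n\<close> grows, whatever \<open>d\<close> is.\<close>

lemma phi_hat_tail:
  assumes n: "1 \<le> n" and K: "0 < K"
  shows "\<exists>A\<in>events. 1 - (\<sigma>\<^sup>2 * \<sigma>\<^sup>2 / (1 - \<phi>\<^sup>2) / K\<^sup>2 + (64 / (1 - \<phi>\<^sup>2) + 4 * real p + 32) / real n) \<le> prob A \<and>
    (\<forall>\<omega>\<in>A. \<bar>phi_hat (residual_proj X * error_mat n d E \<omega>) - \<phi>\<bar>
       \<le> 8 * K / \<sigma>\<^sup>2 * real (n * d) powr (-1/2))"
proof -
  define \<kappa> where "\<kappa> = \<sigma>\<^sup>2 * \<sigma>\<^sup>2 / (1 - \<phi>\<^sup>2)"
  let ?T = "one_step_times {1..<d}" and ?T' = "one_step_times {..<d - 1}"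
  define m where "m = real (d - 1) * real n * \<sigma>\<^sup>2"
  define y where "y = real (n * d)"
  define a where "a = K * sqrt y"
  have d1: "1 \<le> real (d - 1)" using d by simp
  have m0: "0 < m" using d n sigma by (simp add: m_def)
  have y0: "0 < y" using d n by (simp add: y_def)
  have a0: "0 < a" using y0 K by (simp add: a_def)
  have \<kappa>: "0 \<le> \<kappa>" using phi_square_less_1 by (simp add: \<kappa>_def)
  have dn: "0 < real (d - 1)" "0 < real n" using d n by auto
  \<comment> \<open>The moment bounds carry \<open>(d - 1) * n\<close>; as \<open>d - 1\<close> may
    be as small as 1, only the decay in \<open>n\<close> is kept.\<close>
  have inv_le: "c / (real (d - 1) * real n) \<le> c / real n" if "0 \<le> c" for c
    using that d1 dn by (intro divide_left_mono) (auto simp: mult_le_cancel_right1)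
  \<comment> \<open>\<open>B1\<close> is the bad event for the numerator, at the scale of its
    standard deviation; \<open>B2\<close>, \<open>B3\<close> and \<open>B4\<close> are those for the
    denominator, with the thresholds of \<open>phi_hat_deviation\<close>.\<close>
  define B1 where "B1 = {\<omega> \<in> space M. a \<le> \<bar>cross_form R ?T \<omega>\<bar>}"
  define B2 where "B2 = {\<omega> \<in> space M. m / 8 \<le> \<bar>cross_form R ?T' \<omega>\<bar>}"
  define B3 where "B3 = {\<omega> \<in> space M. m / 4 \<le> Z_energy H ?T' \<omega>}"
  define B4 where "B4 = {\<omega> \<in> space M. m / 4 \<le> \<bar>centred_Z_energy ?T' \<omega>\<bar>}"
  have sqT: "square_integrable M (cross_form R ?T)"
    "expectation (\<lambda>\<omega>. (cross_form R ?T \<omega>)\<^sup>2) = real (d - 1) * \<kappa> * (\<Sum>i<n. \<Sum>j<n. (R i j)\<^sup>2)"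
    by (simp_all only: \<kappa>_def cross_form_second_moment one_step_times finite_atLeastLessThan card_atLeastLessThan)
  have sqT': "square_integrable M (cross_form R ?T')"
    "expectation (\<lambda>\<omega>. (cross_form R ?T' \<omega>)\<^sup>2) = real (d - 1) * \<kappa> * (\<Sum>i<n. \<Sum>j<n. (R i j)\<^sup>2)"
    by (simp_all only: \<kappa>_def cross_form_second_moment one_step_times finite_lessThan card_lessThan)
  have cen: "square_integrable M (centred_Z_energy ?T')"
    "expectation (\<lambda>\<omega>. (centred_Z_energy ?T' \<omega>)\<^sup>2) = real (d - 1) * real n * (2 * \<sigma> ^ 4)"
    by (simp_all only: centred_Z_energy_second_moment one_step_times finite_lessThan card_lessThan)
  have en: "integrable M (Z_energy H ?T')"
    "expectation (Z_energy H ?T') = real (d - 1) * \<sigma>\<^sup>2 * (\<Sum>i<n. \<Sum>j<n. (H i j)\<^sup>2)"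
    by (simp_all only: Z_energy_expectation one_step_times finite_lessThan card_lessThan)
  have [measurable]: "cross_form R ?T \<in> borel_measurable M" "cross_form R ?T' \<in> borel_measurable M"
    "Z_energy H ?T' \<in> borel_measurable M" "centred_Z_energy ?T' \<in> borel_measurable M"
    using sqT(1) sqT'(1) cen(1) en(1) by (auto simp: square_integrable_def)
  have B: "B1 \<in> events" "B2 \<in> events" "B3 \<in> events" "B4 \<in> events"
    unfolding B1_def B2_def B3_def B4_def by measurable
  have P1: "prob B1 \<le> \<kappa> / K\<^sup>2"
  proof -
    have "prob B1 \<le> expectation (\<lambda>\<omega>. (cross_form R ?T \<omega>)\<^sup>2) / a\<^sup>2"
      unfolding B1_def by (rule second_moment_tail) (use sqT a0 in auto)
    also have "\<dots> \<le> real d * \<kappa> * real n / a\<^sup>2"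
      unfolding sqT(2) using \<kappa> residual_entries_square_sum
      by (intro divide_right_mono mult_mono) (auto intro!: sum_nonneg)
    also have "real d * \<kappa> * real n = \<kappa> * y" by (simp add: y_def mult_ac)
    also have "\<kappa> * y / a\<^sup>2 = \<kappa> * y / (K\<^sup>2 * y)"
      using y0 by (simp add: a_def power_mult_distrib)
    also have "\<dots> = \<kappa> / K\<^sup>2" using y0 by simp
    finally show ?thesis .
  qed
  \<comment> \<open>64 is the square of the 8 in the threshold, and \<open>\<sigma> ^ 4\<close>
    cancels between \<open>\<kappa>\<close> and \<open>m\<^sup>2\<close>.\<close>
  have P2: "prob B2 \<le> 64 / (1 - \<phi>\<^sup>2) / real n"
  proof -
    have "prob B2 \<le> expectation (\<lambda>\<omega>. (cross_form R ?T' \<omega>)\<^sup>2) / (m / 8)\<^sup>2"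
      unfolding B2_def by (rule second_moment_tail) (use sqT' m0 in auto)
    also have "\<dots> \<le> real (d - 1) * \<kappa> * real n / (m / 8)\<^sup>2"
      unfolding sqT'(2) using \<kappa> residual_entries_square_sum
      by (intro divide_right_mono mult_left_mono) (auto intro!: mult_nonneg_nonneg)
    also have "\<dots> = 64 / (1 - \<phi>\<^sup>2) / (real (d - 1) * real n)"
      unfolding m_def \<kappa>_def using dn sigma by (simp add: power2_eq_square)
    also have "\<dots> \<le> 64 / (1 - \<phi>\<^sup>2) / real n"
      using phi_square_less_1 by (intro inv_le) simp
    finally show ?thesis .
  qed
  \<comment> \<open>The energy is nonnegative with expectation
    \<open>p * (d - 1) * \<sigma>\<^sup>2\<close>, so its first moment already gives decay in
    \<open>n\<close>.\<close>
  have P3: "prob B3 \<le> 4 * real p / real n"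
  proof -
    have "0 \<le> Z_energy H ?T' \<omega>" for \<omega> by (simp add: Z_energy_def sum_nonneg)
    then have "prob B3 \<le> expectation (Z_energy H ?T') / (m / 4)"
      unfolding B3_def using en(1) m0
      by (intro integral_Markov_inequality_measure[of _ _ "{}"]) auto
    also have "\<dots> = 4 * real p / real n"
      unfolding en(2) hat_entries_square_sum m_def using dn sigma by (simp add: field_simps)
    finally show ?thesis .
  qed
  have P4: "prob B4 \<le> 32 / real n"
  proof -
    have "prob B4 \<le> expectation (\<lambda>\<omega>. (centred_Z_energy ?T' \<omega>)\<^sup>2) / (m / 4)\<^sup>2"
      unfolding B4_def by (rule second_moment_tail) (use cen m0 in auto)
    also have "\<dots> = 32 / (real (d - 1) * real n)"
      unfolding cen(2) m_def using dn sigma by (simp add: power2_eq_square power4_eq_xxxx)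
    also have "\<dots> \<le> 32 / real n" by (intro inv_le) simp
    finally show ?thesis .
  qed
  \<comment> \<open>The set on which the recursion fails is enclosed in a measurable null
    set.\<close>
  obtain B0 where B0: "{\<omega> \<in> space M. \<not> follows_ar1 d \<omega>} \<subseteq> B0" "emeasure M B0 = 0" "B0 \<in> events"
    using AE_E[OF AE_follows_ar1] by blast
  define A where "A = space M - (B0 \<union> B1 \<union> B2 \<union> B3 \<union> B4)"
  have U: "B0 \<union> B1 \<union> B2 \<union> B3 \<union> B4 \<in> events" using B B0 by auto
  have "prob (B0 \<union> B1 \<union> B2 \<union> B3 \<union> B4) \<le> prob B0 + prob B1 + prob B2 + prob B3 + prob B4"
    using B B0 by (intro order_trans[OF measure_Un_le] add_mono) auto
  also have "prob B0 = 0" using B0 by (simp add: measure_def)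
  finally have "1 - (\<kappa> / K\<^sup>2 + (64 / (1 - \<phi>\<^sup>2) + 4 * real p + 32) / real n) \<le> prob A"
    unfolding A_def prob_compl[OF U] add_divide_distrib using P1 P2 P3 P4 by linarith
  moreover have "A \<in> events" unfolding A_def using U by auto
  moreover have "\<bar>phi_hat (residual_proj X * error_mat n d E \<omega>) - \<phi>\<bar>
      \<le> 8 * K / \<sigma>\<^sup>2 * real (n * d) powr (-1/2)" if "\<omega> \<in> A" for \<omega>
  proof -
    have "\<bar>phi_hat (residual_proj X * error_mat n d E \<omega>) - \<phi>\<bar> \<le> 4 * a / m"
      by (rule phi_hat_deviation[OF _ _ _ _ _ m_def m0])
        (use that B0(1) in \<open>auto simp: A_def B1_def B2_def B3_def B4_def\<close>)
    \<comment> \<open>For \<open>d\<close> at least 2, \<open>d - 1\<close> is at least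
      \<open>d / 2\<close>; this doubles the constant and yields the rate in
      \<open>n * d\<close>.\<close>
    also have "\<dots> \<le> 4 * a / (y / 2 * \<sigma>\<^sup>2)"
    proof (rule divide_left_mono)
      have "y / 2 = real d / 2 * real n" by (simp add: y_def)
      also have "\<dots> \<le> real (d - 1) * real n" using d by (intro mult_right_mono) (auto simp: of_nat_diff)
      finally show "y / 2 * \<sigma>\<^sup>2 \<le> m" unfolding m_def by (rule mult_right_mono) simp
      show "0 < m * (y / 2 * \<sigma>\<^sup>2)" using m0 y0 sigma by simp
    qed (use a0 in simp)
    also have "\<dots> = 8 * K / \<sigma>\<^sup>2 * (sqrt y / y)" by (simp add: a_def mult_ac)
    also have "sqrt y / y = y powr (-1/2)" by (rule sqrt_divide_self_powr[OF y0])
    finally show ?thesis unfolding y_def .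
  qed
  ultimately show ?thesis unfolding \<kappa>_def by blast
qed

end

end

section \<open>Stochastic order of the plug-in estimators\<close>

text \<open>A Lipschitz bound near 0 suffices: on the event where \<open>X\<close> is at most
  \<open>C * r n\<close>, it is eventually within \<open>\<delta>\<close> because \<open>r\<close>
  tends to 0. This leaves \<open>Y\<close> free where the estimate falls outside the unit
  interval.\<close>

lemma bigo_prob_transfer:
  assumes X: "bigo_prob M X r" and r: "r \<longlonglongrightarrow> 0" and \<delta>: "0 < \<delta>" and K: "0 < K"
    and Y: "\<forall>\<^sub>F n in sequentially. \<forall>\<omega>\<in>space (M n). \<bar>X n \<omega>\<bar> \<le> \<delta> \<longrightarrow> \<bar>Y n \<omega>\<bar> \<le> K * \<bar>X n \<omega>\<bar>"
  shows "bigo_prob M Y r"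
  unfolding bigo_prob_def
proof (intro allI impI)
  fix \<epsilon> :: real assume "\<epsilon> > 0"
  then obtain C where C: "C > 0" and ev: "\<forall>\<^sub>F n in sequentially.
      \<exists>A\<in>sets (M n). measure (M n) A \<ge> 1 - \<epsilon> \<and> (\<forall>\<omega>\<in>A. \<bar>X n \<omega>\<bar> \<le> C * r n)"
    using X unfolding bigo_prob_def by blast
  have "(\<lambda>n. C * r n) \<longlonglongrightarrow> 0" using tendsto_mult_left[OF r, of C] by simp
  from order_tendstoD(2)[OF this \<delta>]
  have "\<forall>\<^sub>F n in sequentially.
      \<exists>A\<in>sets (M n). measure (M n) A \<ge> 1 - \<epsilon> \<and> (\<forall>\<omega>\<in>A. \<bar>Y n \<omega>\<bar> \<le> K * C * r n)"
    using ev Y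
  proof eventually_elim
    case (elim n)
    then obtain A where A: "A \<in> sets (M n)" "measure (M n) A \<ge> 1 - \<epsilon>" "\<forall>\<omega>\<in>A. \<bar>X n \<omega>\<bar> \<le> C * r n" by blast
    have "\<bar>Y n \<omega>\<bar> \<le> K * C * r n" if "\<omega> \<in> A" for \<omega>
    proof -
      have "\<bar>X n \<omega>\<bar> \<le> C * r n" "\<omega> \<in> space (M n)" using A that sets.sets_into_space by auto
      then have "\<bar>Y n \<omega>\<bar> \<le> K * \<bar>X n \<omega>\<bar>" using elim by force
      also have "\<dots> \<le> K * (C * r n)" using K \<open>\<bar>X n \<omega>\<bar> \<le> C * r n\<close> by (intro mult_left_mono) auto
      finally show ?thesis by (simp add: mult.assoc)
    qed
    then show ?case using A by blast
  qed
  then show "\<exists>C>0. \<forall>\<^sub>F n in sequentially.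
      \<exists>A\<in>sets (M n). measure (M n) A \<ge> 1 - \<epsilon> \<and> (\<forall>\<omega>\<in>A. \<bar>Y n \<omega>\<bar> \<le> C * r n)"
    using K C by (intro exI[of _ "K * C"]) auto
qed

lemma sample_size_rate_tendsto_0:
  fixes q :: "nat \<Rightarrow> nat"
  assumes "\<And>n. n \<ge> 1 \<Longrightarrow> q n \<ge> 1"
  shows "(\<lambda>n. real (n * q n) powr (-1/2)) \<longlonglongrightarrow> 0"
proof (rule real_tendsto_sandwich[of "\<lambda>_. 0" _ _ "\<lambda>n. real n powr (-1/2)"])
  show "(\<lambda>n. real n powr (-1/2)) \<longlonglongrightarrow> 0"
    by (rule tendsto_neg_powr[OF _ filterlim_real_sequentially]) simp
  show "\<forall>\<^sub>F n in sequentially. real (n * q n) powr (-1/2) \<le> real n powr (-1/2)"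
    using eventually_ge_at_top[of 1]
  proof eventually_elim
    case (elim n)
    have "n * 1 \<le> n * q n" using assms[OF elim] by (intro mult_le_mono2)
    then have "real n \<le> real (n * q n)" unfolding of_nat_le_iff by simp
    then show ?case using elim by (intro powr_mono2') auto
  qed
qed simp_all

text \<open>\<open>Sigma_hat\<close> carries no innovation variance, whereas \<Sigma> is
  proportional to \<open>\<sigma>\<^sup>2\<close>. The rates are therefore stated for
  \<open>Sigma_hat\<close> at unit variance and for its multiple by \<open>\<sigma>\<^sup>2\<close>
  in general; otherwise the difference would stay near \<open>\<sigma>\<^sup>2 - 1\<close> times
  \<open>ar1_corr\<close>.\<close>

theorem proposition7:
  fixes M :: "nat \<Rightarrow> 'a measure"
    and p :: nat and q :: "nat \<Rightarrow> nat"
    and \<phi> \<sigma> :: real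
    and Z E :: "nat \<Rightarrow> nat \<Rightarrow> int \<Rightarrow> 'a \<Rightarrow> real"
    and X B :: "nat \<Rightarrow> real mat"
    and Y Ehat :: "nat \<Rightarrow> 'a \<Rightarrow> real mat"
    and \<Sigma> :: "nat \<Rightarrow> real mat"
  assumes "\<bar>\<phi>\<bar> < 1" and "\<sigma> > 0"
    and q: "\<And>n. n \<ge> 1 \<Longrightarrow> q n \<ge> 2"
    and prob: "\<And>n. n \<ge> 1 \<Longrightarrow> prob_space (M n)"
    and Z_normal: "\<And>n i t. n \<ge> 1 \<Longrightarrow> i \<in> {1..n} \<Longrightarrow>
          distributed (M n) lborel (Z n i t) (normal_density 0 \<sigma>)"
    and Z_indep: "\<And>n. n \<ge> 1 \<Longrightarrow>
          prob_space.indep_vars (M n) (\<lambda>_. borel) (\<lambda>(i, t). Z n i t) ({1..n} \<times> UNIV)"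
    and ar1: "\<And>n i. n \<ge> 1 \<Longrightarrow> i \<in> {1..n} \<Longrightarrow> stationary_ar1 (M n) \<phi> (Z n i) (E n i)"
    and Sigma: "\<And>n i. n \<ge> 1 \<Longrightarrow> i \<in> {1..n} \<Longrightarrow> \<Sigma> n = cov_mat (M n) (q n) (E n i)"
    and design: "\<And>n. n > p \<Longrightarrow> X n \<in> carrier_mat n p"
          "\<And>n. n > p \<Longrightarrow> invertible_mat ((X n)\<^sup>T * X n)"
    and coeff: "\<And>n. n > p \<Longrightarrow> B n \<in> carrier_mat p (q n)"
    and model: "\<And>n \<omega>. n > p \<Longrightarrow> \<omega> \<in> space (M n) \<Longrightarrow>
          Y n \<omega> = X n * B n + error_mat n (q n) (E n) \<omega>"
    and Ehat: "\<And>n \<omega>. n > p \<Longrightarrow> \<omega> \<in> space (M n) \<Longrightarrow> Ehat n \<omega> = residuals (X n) (Y n \<omega>)"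
  shows
    "(\<exists>M6>0. \<forall>n\<ge>1. lambda_max (mat_inv (\<Sigma> n)) \<le> M6)
     \<and> (\<exists>M7>0. \<forall>n\<ge>1. lambda_min (mat_inv (\<Sigma> n)) \<ge> M7)
     \<and> (\<sigma>\<^sup>2 = 1 \<longrightarrow>
          bigo_prob M
            (\<lambda>n \<omega>. mat_inf_norm (mat_inv (\<Sigma> n) - mat_inv (Sigma_hat (Ehat n \<omega>))))
            (\<lambda>n. real (n * q n) powr (-1/2))
        \<and> bigo_prob M
            (\<lambda>n \<omega>. spec_rad (\<Sigma> n - Sigma_hat (Ehat n \<omega>)))
            (\<lambda>n. real (n * q n) powr (-1/2)))
     \<and> bigo_prob M
          (\<lambda>n \<omega>. mat_inf_norm (mat_inv (\<Sigma> n) - mat_inv (\<sigma>\<^sup>2 \<cdot>\<^sub>m Sigma_hat (Ehat n \<omega>))))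
          (\<lambda>n. real (n * q n) powr (-1/2))
     \<and> bigo_prob M
          (\<lambda>n \<omega>. spec_rad (\<Sigma> n - \<sigma>\<^sup>2 \<cdot>\<^sub>m Sigma_hat (Ehat n \<omega>)))
          (\<lambda>n. real (n * q n) powr (-1/2))"
proof -
  \<comment> \<open>\<open>\<delta>\<close> is half the distance from
    \<open>\<bar>\<phi>\<bar>\<close> to 1, and \<open>\<rho>\<close> is
    \<open>\<bar>\<phi>\<bar> + \<delta>\<close>: an estimate within \<open>\<delta>\<close> of
    \<phi> is bounded by \<open>\<rho> < 1\<close>.\<close>
  define \<rho> where "\<rho> = (1 + \<bar>\<phi>\<bar>) / 2"
  define \<delta> where "\<delta> = (1 - \<bar>\<phi>\<bar>) / 2"
  have \<phi>: "\<bar>\<phi>\<bar> < 1" "\<phi>\<^sup>2 < 1" and \<sigma>: "0 < \<sigma>\<^sup>2" "0 < 1 / \<sigma>\<^sup>2"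
    and \<delta>: "0 < \<delta>" and \<rho>: "\<rho> < 1" "\<bar>\<phi>\<bar> \<le> \<rho>"
    using assms(1,2) by (auto simp: abs_square_less_1 \<delta>_def \<rho>_def)
  have system: "ar1_rows (M n) n \<phi> \<sigma> (Z n) (E n)" if n: "n \<ge> 1" for n
    unfolding ar1_rows_def ar1_rows_axioms_def
    using prob[OF n] assms(1,2) Z_normal[OF n] Z_indep[OF n] ar1[OF n] by blast
  have \<Sigma>: "\<Sigma> n = \<sigma>\<^sup>2 \<cdot>\<^sub>m ar1_corr (q n) \<phi>" if n: "n \<ge> 1" for n
  proof -
    have "\<Sigma> n = cov_mat (M n) (q n) (E n 1)" using Sigma[OF n, of 1] n by simp
    also have "\<dots> = mat (q n) (q n) (\<lambda>(k, l). \<sigma>\<^sup>2 * (\<phi> ^ nat \<bar>int k - int l\<bar> / (1 - \<phi>\<^sup>2)))"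
      using n by (intro ar1_rows.cov_mat_E[OF system[OF n]]) simp
    finally show ?thesis by (auto simp: ar1_corr_def)
  qed
  have \<Sigma>_inv: "mat_inv (\<Sigma> n) = (1 / \<sigma>\<^sup>2) \<cdot>\<^sub>m ar1_prec (q n) \<phi>" if n: "n \<ge> 1" for n
    unfolding \<Sigma>[OF n] using mat_inv_smult_ar1_corr[OF q[OF n] \<phi>(2)] \<sigma> by simp

  \<comment> \<open>Uniform eigenvalue bounds for the precision matrix\<close>
  have A7: "\<exists>M6>0. \<forall>n\<ge>1. lambda_max (mat_inv (\<Sigma> n)) \<le> M6"
    using ar1_prec_lambda_bounds(1)[OF q \<phi>(1) \<sigma>(2)] \<Sigma>_inv \<sigma> \<phi>(1)
    by (intro exI[of _ "1 / \<sigma>\<^sup>2 * (1 + \<bar>\<phi>\<bar>)\<^sup>2"] conjI mult_pos_pos zero_less_power) auto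
  have A8: "\<exists>M7>0. \<forall>n\<ge>1. lambda_min (mat_inv (\<Sigma> n)) \<ge> M7"
    using ar1_prec_lambda_bounds(2)[OF q \<phi>(1) \<sigma>(2)] \<Sigma>_inv \<sigma> \<phi>(1)
    by (intro exI[of _ "1 / \<sigma>\<^sup>2 * (1 - \<bar>\<phi>\<bar>)\<^sup>2"] conjI mult_pos_pos zero_less_power) auto

  \<comment> \<open>Rate of the autoregression estimator\<close>
  let ?r = "\<lambda>n. real (n * q n) powr (-1/2)"
  define \<psi> where "\<psi> n \<omega> = phi_hat (Ehat n \<omega>)" for n \<omega>
  have r0: "?r \<longlonglongrightarrow> 0" using sample_size_rate_tendsto_0[of q] q by force
  have Ehat_eq: "Ehat n \<omega> = residual_proj (X n) * error_mat n (q n) (E n) \<omega>"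
    if "n > p" "\<omega> \<in> space (M n)" for n \<omega>
    using Ehat[OF that] model[OF that] residuals_linear_model[OF design(1) coeff _ design(2)] that
    by (simp add: error_mat_def)
  have Sigma_hat_eq: "Sigma_hat (Ehat n \<omega>) = ar1_corr (q n) (\<psi> n \<omega>)" if "n > p" "\<omega> \<in> space (M n)" for n \<omega>
    unfolding Sigma_hat_def ar1_corr_def \<psi>_def Ehat_eq[OF that] by (simp add: error_mat_def)

  have consistent: "bigo_prob M (\<lambda>n \<omega>. \<psi> n \<omega> - \<phi>) ?r"
    unfolding bigo_prob_def
  proof (intro allI impI)
    fix \<epsilon> :: real assume \<epsilon>: "\<epsilon> > 0"
    define \<kappa> where "\<kappa> = \<sigma>\<^sup>2 * \<sigma>\<^sup>2 / (1 - \<phi>\<^sup>2)"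
    define C\<^sub>0 where "C\<^sub>0 = 64 / (1 - \<phi>\<^sup>2) + 4 * real p + 32"
    \<comment> \<open>This choice spends half of \<epsilon> on the numerator; the other half absorbs
      the term of order \<open>1 / n\<close>.\<close>
    define K where "K = sqrt (2 * \<kappa> / \<epsilon>)"
    have \<kappa>: "0 < \<kappa>" using \<phi> \<sigma> by (simp add: \<kappa>_def)
    then have K: "0 < K" and \<kappa>K: "\<kappa> / K\<^sup>2 = \<epsilon> / 2" using \<epsilon> by (simp_all add: K_def)
    have "(\<lambda>n. C\<^sub>0 / real n) \<longlonglongrightarrow> 0" by (rule lim_const_over_n)
    then have "\<forall>\<^sub>F n in sequentially. C\<^sub>0 / real n < \<epsilon> / 2"
      by (rule order_tendstoD(2)) (use \<epsilon> in simp)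
    then have "\<forall>\<^sub>F n in sequentially.
        \<exists>A\<in>sets (M n). measure (M n) A \<ge> 1 - \<epsilon> \<and> (\<forall>\<omega>\<in>A. \<bar>\<psi> n \<omega> - \<phi>\<bar> \<le> 8 * K / \<sigma>\<^sup>2 * ?r n)"
      using eventually_gt_at_top[of p]
    proof eventually_elim
      case (elim n)
      then have n: "n \<ge> 1" by simp
      from ar1_rows.phi_hat_tail[OF system[OF n] design(1,2)[OF elim(2)] q[OF n] n K]
      obtain A where A: "A \<in> sets (M n)" "1 - (\<kappa> / K\<^sup>2 + C\<^sub>0 / real n) \<le> measure (M n) A"
        "\<forall>\<omega>\<in>A. \<bar>phi_hat (residual_proj (X n) * error_mat n (q n) (E n) \<omega>) - \<phi>\<bar> \<le> 8 * K / \<sigma>\<^sup>2 * ?r n"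
        unfolding \<kappa>_def C\<^sub>0_def by blast
      have "\<bar>\<psi> n \<omega> - \<phi>\<bar> \<le> 8 * K / \<sigma>\<^sup>2 * ?r n" if "\<omega> \<in> A" for \<omega>
        using A(1,3) that sets.sets_into_space Ehat_eq[OF elim(2)] unfolding \<psi>_def by (metis subsetD)
      moreover have "1 - \<epsilon> \<le> measure (M n) A" using A(2) elim(1) \<kappa>K by linarith
      ultimately show ?case using A(1) by blast
    qed
    then show "\<exists>C>0. \<forall>\<^sub>F n in sequentially.
        \<exists>A\<in>sets (M n). measure (M n) A \<ge> 1 - \<epsilon> \<and> (\<forall>\<omega>\<in>A. \<bar>\<psi> n \<omega> - \<phi>\<bar> \<le> C * ?r n)"
      using K \<sigma> by (intro exI[of _ "8 * K / \<sigma>\<^sup>2"]) auto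
  qed
  have \<psi>_le: "\<bar>\<psi> n \<omega>\<bar> \<le> \<rho>" if "\<bar>\<psi> n \<omega> - \<phi>\<bar> \<le> \<delta>" for n \<omega>
  proof -
    have "\<bar>\<psi> n \<omega>\<bar> \<le> \<bar>\<psi> n \<omega> - \<phi>\<bar> + \<bar>\<phi>\<bar>" by linarith
    also have "\<dots> \<le> \<delta> + \<bar>\<phi>\<bar>" using that by simp
    also have "\<dots> = \<rho>" by (simp add: \<delta>_def \<rho>_def field_simps)
    finally show ?thesis .
  qed

  \<comment> \<open>Rates of the plug-in estimators\<close>
  have A9: "bigo_prob M (\<lambda>n \<omega>. mat_inf_norm (mat_inv (\<Sigma> n) - mat_inv (\<sigma>\<^sup>2 \<cdot>\<^sub>m Sigma_hat (Ehat n \<omega>)))) ?r"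
  proof (rule bigo_prob_transfer[OF consistent r0 \<delta>])
    show "0 < 1 / \<sigma>\<^sup>2 * 4" using \<sigma> by simp
    show "\<forall>\<^sub>F n in sequentially. \<forall>\<omega>\<in>space (M n). \<bar>\<psi> n \<omega> - \<phi>\<bar> \<le> \<delta> \<longrightarrow>
        \<bar>mat_inf_norm (mat_inv (\<Sigma> n) - mat_inv (\<sigma>\<^sup>2 \<cdot>\<^sub>m Sigma_hat (Ehat n \<omega>)))\<bar> \<le> 1 / \<sigma>\<^sup>2 * 4 * \<bar>\<psi> n \<omega> - \<phi>\<bar>"
      using eventually_gt_at_top[of p]
    proof eventually_elim
      case (elim n)
      then have n: "n \<ge> 1" by simp
      show ?case
      proof (intro ballI impI)
        fix \<omega> assume \<omega>: "\<omega> \<in> space (M n)" and close: "\<bar>\<psi> n \<omega> - \<phi>\<bar> \<le> \<delta>"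
        \<comment> \<open>Near \<phi> the estimate stays inside the unit interval, so the estimated
          matrix is invertible and its inverse is the explicit tridiagonal one; elsewhere
          \<open>mat_inv\<close> may be unspecified.\<close>
        have \<psi>1: "\<bar>\<psi> n \<omega>\<bar> < 1" using \<psi>_le[OF close] \<rho> by linarith
        then have "(\<psi> n \<omega>)\<^sup>2 < 1" by (simp add: abs_square_less_1)
        then have inv: "mat_inv (\<sigma>\<^sup>2 \<cdot>\<^sub>m Sigma_hat (Ehat n \<omega>)) = (1 / \<sigma>\<^sup>2) \<cdot>\<^sub>m ar1_prec (q n) (\<psi> n \<omega>)"
          unfolding Sigma_hat_eq[OF elim \<omega>] using mat_inv_smult_ar1_corr[OF q[OF n]] \<sigma> by simp
        have eq: "mat_inv (\<Sigma> n) - mat_inv (\<sigma>\<^sup>2 \<cdot>\<^sub>m Sigma_hat (Ehat n \<omega>)) =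
            (1 / \<sigma>\<^sup>2) \<cdot>\<^sub>m (ar1_prec (q n) \<phi> - ar1_prec (q n) (\<psi> n \<omega>))"
          unfolding \<Sigma>_inv[OF n] inv by (auto simp: ar1_prec_def right_diff_distrib)
        have "row_sums_le (ar1_prec (q n) \<phi> - ar1_prec (q n) (\<psi> n \<omega>)) (4 * \<bar>\<phi> - \<psi> n \<omega>\<bar>)"
          using \<phi>(1) \<psi>1 by (intro ar1_prec_diff_row_sums) auto
        from row_sums_le_smult[OF this, of "1 / \<sigma>\<^sup>2"]
        have "\<bar>mat_inf_norm (mat_inv (\<Sigma> n) - mat_inv (\<sigma>\<^sup>2 \<cdot>\<^sub>m Sigma_hat (Ehat n \<omega>)))\<bar>
            \<le> 1 / \<sigma>\<^sup>2 * (4 * \<bar>\<phi> - \<psi> n \<omega>\<bar>)"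
          unfolding eq using q[OF n] by (intro mat_inf_norm_abs_le[of _ "q n"]) (auto simp: minus_carrier_mat)
        then show "\<bar>mat_inf_norm (mat_inv (\<Sigma> n) - mat_inv (\<sigma>\<^sup>2 \<cdot>\<^sub>m Sigma_hat (Ehat n \<omega>)))\<bar>
            \<le> 1 / \<sigma>\<^sup>2 * 4 * \<bar>\<psi> n \<omega> - \<phi>\<bar>"
          by (simp add: abs_minus_commute)
      qed
    qed
  qed

  have A10: "bigo_prob M (\<lambda>n \<omega>. spec_rad (\<Sigma> n - \<sigma>\<^sup>2 \<cdot>\<^sub>m Sigma_hat (Ehat n \<omega>))) ?r"
  proof (rule bigo_prob_transfer[OF consistent r0 \<delta>])
    \<comment> \<open>\<open>L\<close> depends on \<open>\<rho>\<close> alone, so the Lipschitz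
      bound survives a growing dimension \<open>q n\<close>.\<close>
    define L where "L = (2 / ((1 - \<rho>) * (1 - \<rho>\<^sup>2)))\<^sup>2 * 4"
    have "\<rho>\<^sup>2 < 1" using \<rho> by (auto simp: abs_square_less_1)
    then show "0 < \<sigma>\<^sup>2 * L" using \<sigma> \<rho> by (simp add: L_def)
    show "\<forall>\<^sub>F n in sequentially. \<forall>\<omega>\<in>space (M n). \<bar>\<psi> n \<omega> - \<phi>\<bar> \<le> \<delta> \<longrightarrow>
        \<bar>spec_rad (\<Sigma> n - \<sigma>\<^sup>2 \<cdot>\<^sub>m Sigma_hat (Ehat n \<omega>))\<bar> \<le> \<sigma>\<^sup>2 * L * \<bar>\<psi> n \<omega> - \<phi>\<bar>"
      using eventually_gt_at_top[of p]
    proof eventually_elim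
      case (elim n)
      then have n: "n \<ge> 1" by simp
      show ?case
      proof (intro ballI impI)
        fix \<omega> assume \<omega>: "\<omega> \<in> space (M n)" and close: "\<bar>\<psi> n \<omega> - \<phi>\<bar> \<le> \<delta>"
        have eq: "\<Sigma> n - \<sigma>\<^sup>2 \<cdot>\<^sub>m Sigma_hat (Ehat n \<omega>) =
            \<sigma>\<^sup>2 \<cdot>\<^sub>m (ar1_corr (q n) \<phi> - ar1_corr (q n) (\<psi> n \<omega>))"
          unfolding \<Sigma>[OF n] Sigma_hat_eq[OF elim \<omega>] by (auto simp: ar1_corr_def right_diff_distrib)
        have "row_sums_le (ar1_corr (q n) \<phi> - ar1_corr (q n) (\<psi> n \<omega>)) (L * \<bar>\<phi> - \<psi> n \<omega>\<bar>)"
          unfolding L_def by (rule ar1_corr_diff_row_sums[OF q[OF n] \<rho>(2) \<psi>_le[OF close] \<rho>(1)])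
        from row_sums_le_smult[OF this, of "\<sigma>\<^sup>2"]
        have "\<bar>spec_rad (\<Sigma> n - \<sigma>\<^sup>2 \<cdot>\<^sub>m Sigma_hat (Ehat n \<omega>))\<bar> \<le> \<sigma>\<^sup>2 * (L * \<bar>\<phi> - \<psi> n \<omega>\<bar>)"
          unfolding eq using q[OF n] by (intro spec_rad_abs_le[of _ "q n"]) (auto simp: minus_carrier_mat)
        then show "\<bar>spec_rad (\<Sigma> n - \<sigma>\<^sup>2 \<cdot>\<^sub>m Sigma_hat (Ehat n \<omega>))\<bar> \<le> \<sigma>\<^sup>2 * L * \<bar>\<psi> n \<omega> - \<phi>\<bar>"
          by (simp add: abs_minus_commute mult.assoc)
      qed
    qed
  qed

  \<comment> \<open>At unit variance the claims for \<open>Sigma_hat\<close> itself are the scaled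
    claims with scalar 1.\<close>
  have "1 \<cdot>\<^sub>m S = S" for S :: "real mat" by (intro eq_matI) auto
  then show ?thesis using A7 A8 A9 A10 by (auto split: if_splits)
qed

end
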